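(* Let $1\le k\le p$ and $q\ge 1$ be integers, let $\mathscr{U}\subset\mathbb{R}^q$ be open, and let $A^1,\dots,A^p$ be smooth $q\times q$ matrix-valued functions on $\mathscr{U}$. Let $\lambda^1,\dots,\lambda^k$, with $\lambda^j=(\lambda^j_1,\dots,\lambda^j_p):\mathscr{U}\to\mathbb{R}^p$, be smooth wave vectors of the system $A^i(u)\,\partial u/\partial x^i=0$ that are linearly independent at every point of $\mathscr{U}$. Put $r^j(x,u)=\lambda^j_i(u)x^i$ for $j=1,\dots,k$ and $r=(r^1,\dots,r^k)$. Let $\xi_a=(\xi_a^1,\dots,\xi_a^p):\mathscr{U}\to\mathbb{R}^p$, $a=1,\dots,p-k$, be smooth, pointwise linearly independent, and satisfy $\lambda^j_i\xi^i_a=0$ for all $j=1,\dots,k$ and $a=1,\dots,p-k$. Let $X_a=\xi_a^i(u)\,\partial/\partial x^i$, regarded as vector fields on $\mathbb{R}^p\times\mathscr{U}$. Then the following hold. (1) For every smooth function $f$ from a neighborhood of $0\in\mathbb{R}^k$ to $\mathscr{U}$, the implicit equation $$u=f\big(r^1(x,u),\dots,r^k(x,u)\big)$$ defines a unique smooth function $u(x)$ on a neighborhood of $x=0$ (unique as a germ at $0$). On a neighborhood of $x=0$ on which the $k\times k$ matrix $$\phi(x)^i_j=\delta^i_j-\frac{\partial r^i}{\partial u^\alpha}(x,u(x))\,\frac{\partial f^\alpha}{\partial r^j}(r(x,u(x))),\qquad \frac{\partial r^i}{\partial u^\alpha}=\frac{\partial\lambda^i_m}{\partial u^\alpha}x^m,$$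 is invertible, one has, for all $i=1,\dots,p$ and $\alpha=1,\dots,q$, $$\frac{\partial u^\alpha}{\partial x^i}(x)=\big(\phi(x)^{-1}\big)^l_j\,\lambda^j_i(u(x))\,\frac{\partial f^\alpha}{\partial r^l}(r(x,u(x))).$$ In particular, the matrix $(\partial u^\alpha/\partial x^i)$ has rank at most $k$. (2) A smooth function $u$ from a neighborhood of $x=0$ to $\mathscr{U}$ satisfies $u(x)=f(r(x,u(x)))$ near $x=0$ for some smooth $f$ from a neighborhood of $0\in\mathbb{R}^k$ to $\mathscr{U}$ if and only if, near $x=0$, the graph $\{(x,u(x))\}$ is invariant under the vector fields $X_1,\dots,X_{p-k}$. (3) If $u(x)$ is the solution of $u=f(r(x,u))$ as in (1), then, on a neighborhood of $x=0$ on which $\phi(x)$ is invertible, $u$ is a solution of $A^i(u)\,\partial u/\partial x^i=0$ if and only if $$\big(\phi(x)^{-1}\big)^l_j\,\lambda^j_i(u(x))\,A^i(u(x))\,\frac{\partial f}{\partial r^l}(r(x,u(x)))=0.$$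
   Context: The summation convention over repeated indices is used: $\alpha$ runs over $1,\dots,q$; the indices labelling the components of $x$ and of wave vectors (the lower index of $\lambda^j_i$, the index of $A^i$ and $x^i$, and $m$ in $\lambda^i_m x^m$) run over $1,\dots,p$; the indices labelling the wave vectors, the functions $r^j$, the arguments of $f$, and the rows and columns of $\phi$ run over $1,\dots,k$. The symbol $\delta^i_j$ is the Kronecker delta; in $\phi^i_j$ the upper index is the row and the lower index is the column. The system considered is the first-order quasilinear system $A^i(u)\,\partial u/\partial x^i=0$ of $q$ equations for $u=(u^1,\dots,u^q)$ depending on $x=(x^1,\dots,x^p)$. A wave vector of this system is a nowhere-zero vector function $\lambda(u)=(\lambda_1(u),\dots,\lambda_p(u))$ such that $\ker(\lambda_i(u)A^i(u))\neq 0$ for all $u$. The function $r(x,u)=\lambda_i(u)x^i$ is the Riemann invariant associated with $\lambda$. The graph $\{(x,u(x))\}$ is invariant under a vector field $X_a$ if $X_a$ is tangent to it at each of its points; equivalently, $\xi_a^i(u(x))\,\partial u^\alpha/\partial x^i(x)=0$ for all $\alpha$. All considerations are local near $x=0$ and all functions are smooth. *)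

theory Defs
  imports "HOL-Analysis.Analysis"
begin

text \<open>Smoothness, intended for open sets: all iterated directional derivatives exist,
  are Frechet differentiable (hence continuous), to every order.\<close>

primrec higher_differentiable_on ::
  "'a::real_normed_vector set \<Rightarrow> ('a \<Rightarrow> 'b::real_normed_vector) \<Rightarrow> nat \<Rightarrow> bool" where
  "higher_differentiable_on S f 0 \<longleftrightarrow> continuous_on S f"
| "higher_differentiable_on S f (Suc n) \<longleftrightarrow>
     (\<forall>x\<in>S. f differentiable (at x)) \<and>
     (\<forall>v. higher_differentiable_on S (\<lambda>x. frechet_derivative f (at x) v) n)"

definition smooth_on ::
  "'a::real_normed_vector set \<Rightarrow> ('a \<Rightarrow> 'b::real_normed_vector) \<Rightarrow> bool" where
  "smooth_on S f \<longleftrightarrow> (\<forall>n. higher_differentiable_on S f n)"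

definition smooth_map_near0 ::
  "'a::real_normed_vector set \<Rightarrow> ('a \<Rightarrow> 'b::real_normed_vector) \<Rightarrow> 'b set \<Rightarrow> bool" where
  "smooth_map_near0 W f S \<longleftrightarrow> open W \<and> 0 \<in> W \<and> smooth_on W f \<and> f ` W \<subseteq> S"

text \<open>Linear independence of an indexed family (so repeated vectors make it dependent).\<close>

definition independent_family :: "'i set \<Rightarrow> ('i \<Rightarrow> 'v::real_vector) \<Rightarrow> bool" where
  "independent_family I v \<longleftrightarrow> inj_on v I \<and> independent (v ` I)"

definition wave_vector ::
  "(real^'q) set \<Rightarrow> ('p::finite \<Rightarrow> real^'q \<Rightarrow> real^'q^'q) \<Rightarrow> (real^'q \<Rightarrow> real^'p) \<Rightarrow> bool" where
  "wave_vector U A lam \<longleftrightarrow>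
     (\<forall>u\<in>U. lam u \<noteq> 0 \<and> {v. (\<Sum>i\<in>UNIV. lam u $ i *\<^sub>R A i u) *v v = 0} \<noteq> {0})"

text \<open>\<open>column i (jacobian u (at x))\<close> is the partial derivative of \<open>u\<close> with respect to
  the \<open>i\<close>-th coordinate of \<open>x\<close>.\<close>

definition quasilinear_solution_on ::
  "(real^'p) set \<Rightarrow> ('p \<Rightarrow> real^'q \<Rightarrow> real^'q^'q) \<Rightarrow> (real^'p \<Rightarrow> real^'q) \<Rightarrow> bool" where
  "quasilinear_solution_on M A u \<longleftrightarrow>
     (\<forall>x\<in>M. (\<Sum>i\<in>UNIV. A i (u x) *v column i (jacobian u (at x))) = 0)"

definition riemann_invariants ::
  "('k::finite \<Rightarrow> real^'q \<Rightarrow> real^'p) \<Rightarrow> real^'p \<Rightarrow> real^'q \<Rightarrow> real^'k" where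
  "riemann_invariants lam x u = (\<chi> j. \<Sum>i\<in>UNIV. lam j u $ i * x $ i)"

definition implicit_solution ::
  "('k::finite \<Rightarrow> real^'q \<Rightarrow> real^'p) \<Rightarrow> (real^'q) set \<Rightarrow> (real^'k) set \<Rightarrow> (real^'k \<Rightarrow> real^'q) \<Rightarrow>
   (real^'p) set \<Rightarrow> (real^'p \<Rightarrow> real^'q) \<Rightarrow> bool" where
  "implicit_solution lam U W f N u \<longleftrightarrow>
     smooth_map_near0 N u U \<and>
     (\<forall>x\<in>N. riemann_invariants lam x (u x) \<in> W \<and> u x = f (riemann_invariants lam x (u x)))"

definition phi_matrix ::
  "('k::finite \<Rightarrow> real^'q \<Rightarrow> real^'p) \<Rightarrow> (real^'k \<Rightarrow> real^'q) \<Rightarrow> (real^'p \<Rightarrow> real^'q) \<Rightarrow>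
   real^'p \<Rightarrow> real^'k^'k" where
  "phi_matrix lam f u x =
     (\<chi> i j. (if i = j then 1 else 0) -
        (\<Sum>\<alpha>\<in>UNIV. jacobian (riemann_invariants lam x) (at (u x)) $ i $ \<alpha> *
           jacobian f (at (riemann_invariants lam x (u x))) $ \<alpha> $ j))"

text \<open>Tangent vectors at \<open>z\<close> of a subset \<open>S\<close>: velocities of smooth curves lying in \<open>S\<close>.\<close>

definition tangent_vectors :: "'a::real_normed_vector set \<Rightarrow> 'a \<Rightarrow> 'a set" where
  "tangent_vectors S z =
     {v. \<exists>e>0. \<exists>\<gamma>::real \<Rightarrow> 'a. smooth_on {-e<..<e} \<gamma> \<and> \<gamma> ` {-e<..<e} \<subseteq> S \<and> \<gamma> 0 = z \<and>
           (\<gamma> has_vector_derivative v) (at 0)}"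

definition invariant_under :: "('a::real_normed_vector \<Rightarrow> 'a) \<Rightarrow> 'a set \<Rightarrow> bool" where
  "invariant_under X S \<longleftrightarrow> (\<forall>z\<in>S. X z \<in> tangent_vectors S z)"

definition graph_over :: "'a set \<Rightarrow> ('a \<Rightarrow> 'b) \<Rightarrow> ('a \<times> 'b) set" where
  "graph_over M u = (\<lambda>x. (x, u x)) ` M"

text \<open>The vector field \<open>\<xi>\<^sup>i(u) \<partial>/\<partial>x\<^sup>i\<close> on the product space of the pairs \<open>(x, u)\<close>.\<close>

definition horizontal_field ::
  "(real^'q \<Rightarrow> real^'p) \<Rightarrow> (real^'p) \<times> (real^'q) \<Rightarrow> (real^'p) \<times> (real^'q)" where
  "horizontal_field \<xi> z = (\<xi> (snd z), 0)"

end

theory Submission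
  imports Defs
begin

text \<open>
  Write \<open>\<Lambda>(u)\<close> for the \<open>k \<times> p\<close> matrix with rows \<open>\<lambda>\<^sup>j(u)\<close>, so that \<open>r(x, u) = \<Lambda>(u) x\<close>, and put
  \<open>s(x) = r(x, u(x))\<close>.

  The idea is that \<open>s\<close> is a submersion near \<open>0\<close> with \<open>s(0) = 0\<close>, because its derivative at \<open>0\<close> is
  \<open>L = \<Lambda>(u(0))\<close>, which has independent rows. Choose a right inverse \<open>T\<close> of \<open>L\<close>. The coordinates
  \<open>y = x + T (s(x) - L x)\<close> straighten \<open>s\<close>: they satisfy \<open>L y = s(x)\<close>, and the derivative of \<open>y\<close>
  at \<open>0\<close> is the identity. Both nontrivial parts of the theorem use these coordinates.

  For existence and uniqueness (\<open>implicit_riemann_coordinates\<close>), \<open>f\<close> is given and \<open>u = f(L y)\<close> is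
  the unknown. In terms of \<open>y\<close> the implicit equation says \<open>y = B(y) x\<close> with
  \<open>B(y) = 1 + T (\<Lambda>(f(L y)) - L)\<close>. This is linear in \<open>x\<close> and \<open>B(0) = 1\<close>, so \<open>x = B(y)\<inverse> y\<close> is an
  explicit smooth function of \<open>y\<close> with derivative \<open>1\<close> at \<open>0\<close>; its smooth local inverse gives
  \<open>y\<close>, hence \<open>u\<close>, as a function of \<open>x\<close>.

  Conversely (\<open>locally_factors_through_submersion\<close>), \<open>u\<close> is given and \<open>f\<close> is the unknown.
  Invariance of the graph says that the derivative of \<open>u\<close> kills the vectors \<open>\<xi>\<^sub>a(u(x))\<close>
  (\<open>invariant_under_horizontal_field_iff\<close>). The derivative of \<open>s\<close> then kills them too, and by
  counting dimensions they span its kernel. So \<open>u\<close>, seen in the coordinates \<open>y\<close>, is locally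
  constant along \<open>ker L\<close> and therefore a function of \<open>L y = s\<close>.

  Everything else is linear algebra. Let \<open>J\<close>, \<open>S\<close>, \<open>F\<close> and \<open>R\<close> be the Jacobian matrices of
  \<open>u\<close>, \<open>s\<close>, \<open>f\<close> and of \<open>r(x, _)\<close>. Differentiating \<open>s(x) = r(x, u(x))\<close> and \<open>u = f \<circ> s\<close> gives
  \<open>S = \<Lambda> + R J\<close> and \<open>J = F S\<close>. Hence \<open>\<phi> S = \<Lambda>\<close> for \<open>\<phi> = 1 - R F\<close>, that is,
  \<open>J = F \<phi>\<inverse> \<Lambda>\<close> (\<open>implicit_solution_jacobian\<close>). This product factors through \<open>\<real>\<^sup>k\<close>, which bounds
  its rank; it kills \<open>\<xi>\<^sub>a\<close> because \<open>\<Lambda>\<close> does; and inserting it in the system gives the last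
  claim.
\<close>

section \<open>Calculus of finite and infinite differentiability\<close>

lemma higher_differentiable_on_cong:
  assumes "open S" "\<And>x. x \<in> S \<Longrightarrow> f x = g x"
  shows "higher_differentiable_on S f n \<longleftrightarrow> higher_differentiable_on S g n"
  using assms(2)
proof (induction n arbitrary: f g)
  case 0
  then show ?case by (auto cong: continuous_on_cong)
next
  case (Suc n)
  have der: "(f has_derivative D) (at x) \<longleftrightarrow> (g has_derivative D) (at x)" if "x \<in> S" for x D
    using has_derivative_transform_within_open[OF _ assms(1) that] Suc.prems by metis
  have "f differentiable (at x) \<longleftrightarrow> g differentiable (at x)" if "x \<in> S" for x
    using der[OF that] by (simp add: differentiable_def)
  moreover have "frechet_derivative f (at x) = frechet_derivative g (at x)" if "x \<in> S" for x
    using der[OF that] by (simp add: frechet_derivative_def)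
  ultimately show ?case
    using Suc.IH[of "\<lambda>x. frechet_derivative f (at x) v" "\<lambda>x. frechet_derivative g (at x) v" for v]
    by simp
qed

lemma higher_differentiable_on_SucI:
  assumes "open S" and der: "\<And>x. x \<in> S \<Longrightarrow> (f has_derivative f' x) (at x)"
    and "\<And>v. higher_differentiable_on S (\<lambda>x. f' x v) n"
  shows "higher_differentiable_on S f (Suc n)"
proof -
  have "frechet_derivative f (at x) v = f' x v" if "x \<in> S" for x v
    using frechet_derivative_at[OF der[OF that]] by simp
  then show ?thesis
    using assms higher_differentiable_on_cong[OF assms(1), of "\<lambda>x. frechet_derivative f (at x) v" "\<lambda>x. f' x v" for v]
    by (auto simp: differentiable_def)
qed

lemma higher_differentiable_on_SucD:
  "higher_differentiable_on S f (Suc n) \<Longrightarrow> higher_differentiable_on S f n"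
proof (induction n arbitrary: f)
  case 0
  then show ?case
    by (auto intro!: continuous_at_imp_continuous_on differentiable_imp_continuous_within)
next
  case (Suc n)
  then show ?case by (metis higher_differentiable_on.simps(2))
qed

lemma higher_differentiable_on_derivative:
  assumes "higher_differentiable_on S f (Suc n)" "x \<in> S"
  shows "(f has_derivative frechet_derivative f (at x)) (at x)"
  using assms frechet_derivative_works by auto

lemma higher_differentiable_on_subset:
  "higher_differentiable_on S f n \<Longrightarrow> T \<subseteq> S \<Longrightarrow> higher_differentiable_on T f n"
  by (induction n arbitrary: f) (auto intro: continuous_on_subset)

lemma higher_differentiable_on_const:
  "open S \<Longrightarrow> higher_differentiable_on S (\<lambda>x. c) n"
proof (induction n arbitrary: c)
  case (Suc n)
  show ?case
    by (rule higher_differentiable_on_SucI[OF Suc.prems has_derivative_const Suc.IH[OF Suc.prems]])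
qed simp

lemma higher_differentiable_on_linear:
  assumes "open S" "bounded_linear L" "higher_differentiable_on S f n"
  shows "higher_differentiable_on S (\<lambda>x. L (f x)) n"
  using assms(3)
proof (induction n arbitrary: f)
  case 0
  then show ?case using assms(2) by (auto intro: bounded_linear.continuous_on)
next
  case (Suc n)
  show ?case
    by (rule higher_differentiable_on_SucI[OF assms(1)
          bounded_linear.has_derivative[OF assms(2) higher_differentiable_on_derivative[OF Suc.prems]]])
      (use Suc in auto)
qed

lemma higher_differentiable_on_add:
  assumes "open S" "higher_differentiable_on S f n" "higher_differentiable_on S g n"
  shows "higher_differentiable_on S (\<lambda>x. f x + g x) n"
  using assms(2,3)
proof (induction n arbitrary: f g)
  case 0
  then show ?case by (auto intro: continuous_on_add)
next
  case (Suc n)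
  show ?case
    by (rule higher_differentiable_on_SucI[OF assms(1)
          has_derivative_add[OF Suc.prems[THEN higher_differentiable_on_derivative]]])
      (use Suc in auto)
qed

lemma higher_differentiable_on_sum:
  assumes "open S" "\<And>i. i \<in> I \<Longrightarrow> higher_differentiable_on S (f i) n"
  shows "higher_differentiable_on S (\<lambda>x. \<Sum>i\<in>I. f i x) n"
  using assms(2)
  by (induction I rule: infinite_finite_induct)
    (auto intro: higher_differentiable_on_add higher_differentiable_on_const assms(1))

lemma higher_differentiable_on_bilinear:
  assumes "open S" "bounded_bilinear B"
    and "higher_differentiable_on S f n" "higher_differentiable_on S g n"
  shows "higher_differentiable_on S (\<lambda>x. B (f x) (g x)) n"
  using assms(3,4)
proof (induction n arbitrary: f g)
  case 0
  then show ?case using bounded_bilinear.continuous_on[OF assms(2)] by auto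
next
  case (Suc n)
  note lower = Suc.prems[THEN higher_differentiable_on_SucD]
  show ?case
    by (rule higher_differentiable_on_SucI[OF assms(1)
          bounded_bilinear.FDERIV[OF assms(2) Suc.prems[THEN higher_differentiable_on_derivative]]])
      (use Suc lower in \<open>auto intro!: higher_differentiable_on_add[OF assms(1)]\<close>)
qed

lemmas higher_differentiable_on_mult =
  higher_differentiable_on_bilinear[OF _ bounded_bilinear_mult]

lemma higher_differentiable_on_prod:
  fixes f :: "'i \<Rightarrow> 'a::real_normed_vector \<Rightarrow> real"
  assumes "open S" "\<And>i. i \<in> I \<Longrightarrow> higher_differentiable_on S (f i) n"
  shows "higher_differentiable_on S (\<lambda>x. \<Prod>i\<in>I. f i x) n"
  using assms(2)
  by (induction I rule: infinite_finite_induct)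
    (auto intro: higher_differentiable_on_mult higher_differentiable_on_const assms(1))

lemma higher_differentiable_on_inverse:
  fixes f :: "'a::real_normed_vector \<Rightarrow> real"
  assumes "open S" "\<And>x. x \<in> S \<Longrightarrow> f x \<noteq> 0" "higher_differentiable_on S f n"
  shows "higher_differentiable_on S (\<lambda>x. inverse (f x)) n"
  using assms(3)
proof (induction n)
  case 0
  then show ?case using assms(2) by (auto intro: continuous_on_inverse)
next
  case (Suc n)
  have inv: "higher_differentiable_on S (\<lambda>x. inverse (f x)) n"
    using Suc higher_differentiable_on_SucD by blast
  have "higher_differentiable_on S (\<lambda>x. (-1) * (inverse (f x) * frechet_derivative f (at x) v * inverse (f x))) n" for v
    using Suc.prems inv
    by (intro higher_differentiable_on_mult higher_differentiable_on_const assms(1)) auto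
  then show ?case
    by (intro higher_differentiable_on_SucI[OF assms(1) Deriv.has_derivative_inverse[OF assms(2)
          higher_differentiable_on_derivative[OF Suc.prems]]]) auto
qed

text \<open>The direction \<open>Df(x) v\<close> in which \<open>g\<close> is differentiated depends on \<open>x\<close>, so the induction
  hypothesis does not apply to the derivative of the composition at once. Expanding this direction
  in a basis leaves only directional derivatives of \<open>g\<close> in fixed directions.\<close>

lemma higher_differentiable_on_compose:
  fixes f :: "'a::real_normed_vector \<Rightarrow> 'b::euclidean_space"
  assumes S: "open S"
    and "higher_differentiable_on T g n" "higher_differentiable_on S f n" "f ` S \<subseteq> T"
  shows "higher_differentiable_on S (\<lambda>x. g (f x)) n"
  using assms(2,3)
proof (induction n arbitrary: g)
  case 0
  then show ?case using continuous_on_compose2 assms(4) by auto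
next
  case (Suc n)
  let ?f' = "\<lambda>x. frechet_derivative f (at x)" and ?g' = "\<lambda>y. frechet_derivative g (at y)"
  note lower = Suc.prems(2)[THEN higher_differentiable_on_SucD]
  have mem: "f x \<in> T" if "x \<in> S" for x using assms(4) that by blast
  have der: "((\<lambda>x. g (f x)) has_derivative (\<lambda>v. ?g' (f x) (?f' x v))) (at x)" if "x \<in> S" for x
    by (rule has_derivative_compose[OF higher_differentiable_on_derivative[OF Suc.prems(2) that]
          higher_differentiable_on_derivative[OF Suc.prems(1) mem[OF that]]])
  have expand: "?g' (f x) (?f' x v) = (\<Sum>b\<in>Basis. (?f' x v \<bullet> b) *\<^sub>R ?g' (f x) b)" if "x \<in> S" for x v
  proof -
    have lin: "linear (?g' (f x))"
      using has_derivative_linear[OF higher_differentiable_on_derivative[OF Suc.prems(1) mem[OF that]]] .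
    have "?g' (f x) (?f' x v) = ?g' (f x) (\<Sum>b\<in>Basis. (?f' x v \<bullet> b) *\<^sub>R b)"
      by (simp add: euclidean_representation)
    also have "\<dots> = (\<Sum>b\<in>Basis. (?f' x v \<bullet> b) *\<^sub>R ?g' (f x) b)"
      by (simp add: linear_sum[OF lin] linear_scale[OF lin])
    finally show ?thesis .
  qed
  have "higher_differentiable_on S (\<lambda>x. \<Sum>b\<in>Basis. (?f' x v \<bullet> b) *\<^sub>R ?g' (f x) b) n" for v
  proof (intro higher_differentiable_on_sum[OF S] higher_differentiable_on_bilinear[OF S bounded_bilinear_scaleR])
    fix b :: 'b
    show "higher_differentiable_on S (\<lambda>x. ?f' x v \<bullet> b) n"
      using Suc.prems(2) by (intro higher_differentiable_on_linear[OF S bounded_linear_inner_left]) auto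
    show "higher_differentiable_on S (\<lambda>x. ?g' (f x) b) n"
      using Suc.prems(1) lower by (intro Suc.IH) auto
  qed
  then show ?case
    using higher_differentiable_on_cong[OF S expand]
    by (intro higher_differentiable_on_SucI[OF S der]) auto
qed

lemma higher_differentiable_on_vec:
  fixes f :: "'a::real_normed_vector \<Rightarrow> real^'n"
  assumes "open S" "\<And>i. higher_differentiable_on S (\<lambda>x. f x $ i) n"
  shows "higher_differentiable_on S f n"
proof -
  have "f x = (\<Sum>i\<in>UNIV. (f x $ i) *\<^sub>R axis i 1)" for x
    by (simp add: vec_eq_iff axis_def if_distrib cong: if_cong)
  moreover have "higher_differentiable_on S (\<lambda>x. \<Sum>i\<in>UNIV. (f x $ i) *\<^sub>R axis i (1::real)) n"
    by (intro higher_differentiable_on_sum higher_differentiable_on_linear[OF _ bounded_linear_scaleR_left] assms)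
  ultimately show ?thesis by presburger
qed

lemma higher_differentiable_on_det:
  fixes M :: "'a::real_normed_vector \<Rightarrow> real^'n^'n"
  assumes "open S" "\<And>i j. higher_differentiable_on S (\<lambda>x. M x $ i $ j) n"
  shows "higher_differentiable_on S (\<lambda>x. det (M x)) n"
  unfolding det_def
  by (intro higher_differentiable_on_sum higher_differentiable_on_mult higher_differentiable_on_const
      higher_differentiable_on_prod assms)

text \<open>Cramer's rule expresses the solution of a linear system by quotients of determinants, and so
  transfers the differentiability of the data to the solution.\<close>

lemma higher_differentiable_on_linear_system:
  fixes M :: "'a::real_normed_vector \<Rightarrow> real^'n^'n"
  assumes S: "open S" and M: "\<And>i j. higher_differentiable_on S (\<lambda>x. M x $ i $ j) n"
    and b: "higher_differentiable_on S b n"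
    and inv: "\<And>x. x \<in> S \<Longrightarrow> det (M x) \<noteq> 0" and eq: "\<And>x. x \<in> S \<Longrightarrow> M x *v w x = b x"
  shows "higher_differentiable_on S w n"
proof (rule higher_differentiable_on_vec[OF S])
  fix k
  let ?num = "\<lambda>x. det (\<chi> i j. if j = k then b x $ i else M x $ i $ j)"
  have "higher_differentiable_on S (\<lambda>x. ?num x * inverse (det (M x))) n"
  proof (intro higher_differentiable_on_mult higher_differentiable_on_inverse
      higher_differentiable_on_det S M inv)
    fix i j
    show "higher_differentiable_on S (\<lambda>x. (\<chi> i j. if j = k then b x $ i else M x $ i $ j) $ i $ j) n"
      using M[of i j] higher_differentiable_on_linear[OF S bounded_linear_vec_nth b, of i]
      by (cases "j = k") auto
  qed auto
  moreover have "w x $ k = ?num x * inverse (det (M x))" if "x \<in> S" for x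
    using cramer[OF inv[OF that], of "w x" "b x"] eq[OF that] by (simp add: divide_inverse)
  ultimately show "higher_differentiable_on S (\<lambda>x. w x $ k) n"
    using higher_differentiable_on_cong[OF S, of "\<lambda>x. w x $ k"] by auto
qed

text \<open>Invertibility of a continuous matrix is an open condition; all neighbourhoods of \<open>0\<close> on which
  some matrix has to stay invertible come from here.\<close>

lemma open_det_nonzero:
  fixes M :: "'a::real_normed_vector \<Rightarrow> real^'n^'n"
  assumes "open S" "\<And>i j. continuous_on S (\<lambda>x. M x $ i $ j)"
  shows "open {x \<in> S. det (M x) \<noteq> 0}"
proof -
  have "continuous_on S (\<lambda>x. det (M x))"
    using higher_differentiable_on_det[OF assms(1), of M 0] assms(2) by simp
  then have "open (S \<inter> (\<lambda>x. det (M x)) -` (- {0}))"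
    by (rule continuous_open_preimage[OF _ assms(1)]) (intro open_Compl, simp)
  moreover have "S \<inter> (\<lambda>x. det (M x)) -` (- {0}) = {x \<in> S. det (M x) \<noteq> 0}" by auto
  ultimately show ?thesis by simp
qed

lemma smooth_on_derivative:
  assumes "smooth_on S f" "x \<in> S"
  shows "(f has_derivative frechet_derivative f (at x)) (at x)"
  using assms higher_differentiable_on_derivative unfolding smooth_on_def by blast

lemma smooth_on_frechet_derivative:
  "smooth_on S f \<Longrightarrow> smooth_on S (\<lambda>x. frechet_derivative f (at x) v)"
  unfolding smooth_on_def by (metis higher_differentiable_on.simps(2))

lemma smooth_on_imp_continuous_on: "smooth_on S f \<Longrightarrow> continuous_on S f"
  unfolding smooth_on_def by (metis higher_differentiable_on.simps(1))

lemma smooth_on_subset: "smooth_on S f \<Longrightarrow> T \<subseteq> S \<Longrightarrow> smooth_on T f"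
  unfolding smooth_on_def using higher_differentiable_on_subset by blast

lemma smooth_on_linear:
  assumes "open S" "bounded_linear L" "smooth_on S f"
  shows "smooth_on S (\<lambda>x. L (f x))"
  using assms higher_differentiable_on_linear unfolding smooth_on_def by blast

lemma smooth_on_ident:
  assumes "open S"
  shows "smooth_on S (\<lambda>x. x)"
  unfolding smooth_on_def
proof
  fix n show "higher_differentiable_on S (\<lambda>x. x) n"
    by (cases n) (auto intro!: higher_differentiable_on_SucI higher_differentiable_on_const
       assms has_derivative_ident)
qed

lemma smooth_on_const: "open S \<Longrightarrow> smooth_on S (\<lambda>x. c)"
  using higher_differentiable_on_const unfolding smooth_on_def by blast

lemma smooth_on_bilinear:
  assumes "open S" "bounded_bilinear B" "smooth_on S f" "smooth_on S g"
  shows "smooth_on S (\<lambda>x. B (f x) (g x))"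
  using assms higher_differentiable_on_bilinear unfolding smooth_on_def by blast

lemma smooth_on_add:
  assumes "open S" "smooth_on S f" "smooth_on S g"
  shows "smooth_on S (\<lambda>x. f x + g x)"
  using assms higher_differentiable_on_add unfolding smooth_on_def by blast

lemma smooth_on_sum:
  assumes "open S" "\<And>i. i \<in> I \<Longrightarrow> smooth_on S (f i)"
  shows "smooth_on S (\<lambda>x. \<Sum>i\<in>I. f i x)"
  using assms higher_differentiable_on_sum[of S I f] unfolding smooth_on_def by blast

lemma smooth_on_compose:
  fixes f :: "'a::real_normed_vector \<Rightarrow> 'b::euclidean_space"
  assumes "open S" "smooth_on T g" "smooth_on S f" "f ` S \<subseteq> T"
  shows "smooth_on S (\<lambda>x. g (f x))"
  using assms higher_differentiable_on_compose unfolding smooth_on_def by blast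

lemma smooth_on_vec:
  fixes f :: "'a::real_normed_vector \<Rightarrow> real^'n"
  assumes "open S" "\<And>i. smooth_on S (\<lambda>x. f x $ i)"
  shows "smooth_on S f"
  using assms higher_differentiable_on_vec unfolding smooth_on_def by blast

lemma smooth_on_linear_system:
  fixes M :: "'a::real_normed_vector \<Rightarrow> real^'n^'n"
  assumes "open S" "\<And>i j. smooth_on S (\<lambda>x. M x $ i $ j)" "smooth_on S b"
    and "\<And>x. x \<in> S \<Longrightarrow> det (M x) \<noteq> 0" "\<And>x. x \<in> S \<Longrightarrow> M x *v w x = b x"
  shows "smooth_on S w"
  using assms higher_differentiable_on_linear_system[of S M _ b w] unfolding smooth_on_def by blast

section \<open>Derivatives as matrices\<close>

lemma has_derivative_vec:
  fixes f :: "'a::real_normed_vector \<Rightarrow> real^'n"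
  assumes "\<And>i. ((\<lambda>x. f x $ i) has_derivative (\<lambda>v. f' v $ i)) F"
  shows "(f has_derivative f') F"
proof -
  have eq: "w = (\<Sum>i\<in>UNIV. (w $ i) *\<^sub>R axis i 1)" for w :: "real^'n"
    by (simp add: vec_eq_iff axis_def if_distrib cong: if_cong)
  have "((\<lambda>x. \<Sum>i\<in>UNIV. (f x $ i) *\<^sub>R axis i (1::real)) has_derivative
      (\<lambda>v. \<Sum>i\<in>UNIV. (f' v $ i) *\<^sub>R axis i 1)) F"
    by (intro has_derivative_sum has_derivative_scaleR_left assms)
  then show ?thesis by (simp only: eq[symmetric])
qed

lemma jacobian_nth: "jacobian f F $ a $ b = frechet_derivative f F (axis b 1) $ a"
  by (simp add: jacobian_def matrix_def)

lemma smooth_on_jacobian: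
  fixes f :: "real^'m \<Rightarrow> real^'n"
  shows "smooth_on S f \<Longrightarrow> x \<in> S \<Longrightarrow> (f has_derivative (*v) (jacobian f (at x))) (at x)"
  by (rule jacobian_works[THEN iffD1, OF differentiableI[OF smooth_on_derivative]])

lemma continuous_on_jacobian:
  fixes f :: "real^'m \<Rightarrow> real^'n"
  assumes "smooth_on S f"
  shows "continuous_on S (\<lambda>x. jacobian f (at x) $ a $ b)"
  unfolding jacobian_nth
  by (intro continuous_on_component smooth_on_imp_continuous_on smooth_on_frechet_derivative assms)

lemma matrix_inv_mult:
  assumes "invertible (M::real^'n^'n)"
  shows "matrix_inv M ** M = mat 1"
  using assms someI_ex[of "\<lambda>M'. M ** M' = mat 1 \<and> M' ** M = mat 1"]
  unfolding invertible_def matrix_inv_def by auto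

lemma matrix_inv_mult_right:
  assumes "invertible (M::real^'n^'n)"
  shows "M ** matrix_inv M = mat 1"
  using assms someI_ex[of "\<lambda>M'. M ** M' = mat 1 \<and> M' ** M = mat 1"]
  unfolding invertible_def matrix_inv_def by auto

lemma eventually_nhds_preimage:
  fixes f :: "'a::topological_space \<Rightarrow> 'b::topological_space"
  assumes "open M" "x \<in> M" "continuous_on M f" "open V" "f x \<in> V"
  shows "\<forall>\<^sub>F y in nhds x. f y \<in> V"
proof -
  have "open (M \<inter> f -` V)" by (rule continuous_open_preimage[OF assms(3,1,4)])
  then have "\<forall>\<^sub>F y in nhds x. y \<in> M \<inter> f -` V"
    using assms by (intro eventually_nhds_in_open) auto
  then show ?thesis by eventually_elim simp
qed

section \<open>Smooth local inverses and functions of a submersion\<close>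

text \<open>The \<open>C\<^sup>1\<close> inverse function theorem supplies \<open>g\<close>. Smoothness follows by bootstrapping: the
  directional derivative \<open>w\<close> of \<open>g\<close> in direction \<open>v\<close> at \<open>y\<close> solves \<open>DF(g(y)) w = v\<close>, a linear system
  with coefficients that are as differentiable as \<open>g\<close>, so \<open>g\<close> is always one order better than
  already known.\<close>

lemma smooth_local_inverse:
  fixes F :: "real^'n \<Rightarrow> real^'n"
  assumes S: "open S" "x0 \<in> S" and F: "smooth_on S F" and F0: "(F has_derivative id) (at x0)"
  obtains V V' g where "open V" "x0 \<in> V" "V \<subseteq> S" "open V'" "F x0 \<in> V'" "homeomorphism V V' F g"
    "smooth_on V' g"
proof -
  let ?F' = "\<lambda>x. frechet_derivative F (at x)"
  define F' where "F' = (\<lambda>x. Blinfun (?F' x))"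
  have app: "blinfun_apply (F' x) = ?F' x" if "x \<in> S" for x
    unfolding F'_def
    using smooth_on_derivative[OF F that] has_derivative_bounded_linear bounded_linear_Blinfun_apply by blast
  have "continuous_on S F'"
  proof (rule continuous_on_blinfun_componentwise)
    fix i :: "real^'n"
    have "continuous_on S (\<lambda>x. ?F' x i)"
      using smooth_on_imp_continuous_on[OF smooth_on_frechet_derivative[OF F]] .
    then show "continuous_on S (\<lambda>x. blinfun_apply (F' x) i)"
      using app by (auto cong: continuous_on_cong)
  qed
  moreover have "id_blinfun o\<^sub>L F' x0 = id_blinfun"
    using frechet_derivative_at[OF F0, symmetric] app[OF S(2)] by (auto intro!: blinfun_eqI)
  ultimately obtain V V' g g' where V: "open V" "V \<subseteq> S" "x0 \<in> V" "open V'" "F x0 \<in> V'"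
    and hom: "homeomorphism V V' F g"
    and g: "\<And>y. y \<in> V' \<Longrightarrow> (g has_derivative (g' y)) (at y)"
      "\<And>y. y \<in> V' \<Longrightarrow> g' y = inv (blinfun_apply (F'(g y)))"
      "\<And>y. y \<in> V' \<Longrightarrow> bij (blinfun_apply (F'(g y)))"
    using inverse_function_theorem[OF S(1), of F F' x0 id_blinfun] app smooth_on_derivative[OF F] S(2)
    by (smt (verit, ccfv_threshold))
  have gS: "g y \<in> S" if "y \<in> V'" for y
    using that hom V(2) unfolding homeomorphism_def by blast
  have inv: "?F' (g y) (g' y w) = w" if "y \<in> V'" for y w
    using g(2,3)[OF that] app[OF gS[OF that]] by (simp add: bij_is_surj surj_f_inv_f)
  define M where "M = (\<lambda>y. matrix (?F' (g y)))"
  have M: "M y *v w = ?F' (g y) w" if "y \<in> V'" for y w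
    unfolding M_def using has_derivative_linear[OF smooth_on_derivative[OF F gS[OF that]]]
    by (simp add: matrix_works)
  have detM: "det (M y) \<noteq> 0" if "y \<in> V'" for y
  proof -
    have "surj ((*v) (M y))"
      using inv[OF that] M[OF that] by (metis surjI)
    then show ?thesis
      by (metis invertible_det_nz invertible_right_inverse matrix_right_invertible_surjective)
  qed
  have "higher_differentiable_on V' g n" for n
  proof (induction n)
    case 0
    then show ?case using hom unfolding homeomorphism_def by simp
  next
    case (Suc n)
    have "higher_differentiable_on V' (\<lambda>y. ?F' (g y) v) n" for v
      using smooth_on_frechet_derivative[OF F] gS
      by (intro higher_differentiable_on_compose[OF V(4) _ Suc, of S]) (auto simp: smooth_on_def)
    then have "higher_differentiable_on V' (\<lambda>y. M y $ i $ j) n" for i j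
      unfolding M_def matrix_def
      using higher_differentiable_on_linear[OF V(4) bounded_linear_vec_nth] by auto
    then have "higher_differentiable_on V' (\<lambda>y. g' y v) n" for v
      using detM inv M
      by (intro higher_differentiable_on_linear_system[OF V(4) _ higher_differentiable_on_const[OF V(4), of v]])
        auto
    then show ?case using higher_differentiable_on_SucI[OF V(4) g(1)] by blast
  qed
  then have "smooth_on V' g" by (simp add: smooth_on_def)
  then show thesis using that V hom by blast
qed

lemma constant_along_kernel:
  fixes h :: "real^'p \<Rightarrow> 'b::real_normed_vector" and L :: "real^'p^'k"
  assumes B: "convex B" and h: "\<And>y. y \<in> B \<Longrightarrow> (h has_derivative h' y) (at y)"
    and ker: "\<And>y w. y \<in> B \<Longrightarrow> L *v w = 0 \<Longrightarrow> h' y w = 0"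
    and ab: "a \<in> B" "b \<in> B" "L *v a = L *v b"
  shows "h a = h b"
proof -
  let ?c = "\<lambda>t::real. a + t *\<^sub>R (b - a)"
  have c: "?c t \<in> B" if "t \<in> {0..1}" for t
    using B ab that unfolding convex_alt by (simp add: algebra_simps)
  have L0: "L *v (t *\<^sub>R (b - a)) = 0" for t
    using ab(3) by (simp add: matrix_vector_mult_diff_distrib matrix_vector_mult_scaleR)
  have "((\<lambda>t. h (?c t)) has_derivative (\<lambda>t. 0)) (at t within {0..1})" if "t \<in> {0..1}" for t
  proof -
    have "(?c has_derivative (\<lambda>t. t *\<^sub>R (b - a))) (at t within {0..1})"
      by (auto intro!: derivative_eq_intros)
    from has_derivative_compose[OF this h[OF c[OF that]]] show ?thesis
      using ker[OF c[OF that] L0] by simp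
  qed
  from has_derivative_zero_unique[OF _ this, of 0 1] show ?thesis by simp
qed

text \<open>With \<open>L = Ds(x0)\<close>, the map \<open>\<Psi>\<close> below has derivative \<open>1\<close> at \<open>x0\<close> and turns \<open>s\<close> into the linear
  map \<open>L\<close>. In these coordinates \<open>u\<close> is constant along \<open>ker L\<close> on a ball, and \<open>f\<close> is read off on
  the affine section \<open>\<sigma>\<close> of \<open>L\<close>.\<close>

lemma locally_factors_through_submersion:
  fixes s :: "real^'p \<Rightarrow> real^'k" and u :: "real^'p \<Rightarrow> 'b::real_normed_vector"
    and T :: "real^'k^'p"
  assumes M: "open M" "x0 \<in> M" and s: "smooth_on M s" and u: "smooth_on M u"
    and T: "jacobian s (at x0) ** T = mat 1"
    and ker: "\<And>x v. x \<in> M \<Longrightarrow> frechet_derivative s (at x) v = 0 \<Longrightarrow> frechet_derivative u (at x) v = 0"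
  obtains W f where "open W" "s x0 \<in> W" "smooth_on W f" "f ` W \<subseteq> u ` M"
    "\<forall>\<^sub>F x in nhds x0. s x \<in> W \<and> u x = f (s x)"
proof -
  define L where "L = jacobian s (at x0)"
  have LT: "L *v (T *v v) = v" for v
    using T by (simp add: L_def matrix_vector_mul_assoc)
  define \<Psi> where "\<Psi> = (\<lambda>x. x + T *v (s x + L *v (- x)))"
  have L\<Psi>: "L *v \<Psi> x = s x" for x
  proof -
    have "L *v x + L *v (- x) = 0"
      by (simp flip: matrix_vector_right_distrib)
    then show ?thesis
      by (simp add: \<Psi>_def matrix_vector_right_distrib LT add.left_commute)
  qed
  have "smooth_on M \<Psi>"
    unfolding \<Psi>_def
    by (intro smooth_on_add smooth_on_ident M s smooth_on_linear[OF M(1) matrix_vector_mul_bounded_linear]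
        smooth_on_linear[OF M(1) bounded_linear_minus[OF bounded_linear_ident]])
  moreover have "(\<Psi> has_derivative id) (at x0)"
  proof -
    have "(s has_derivative (*v) L) (at x0)"
      unfolding L_def using smooth_on_derivative[OF s M(2)] jacobian_works differentiable_def by blast
    then have "(\<Psi> has_derivative (\<lambda>v. v + T *v (L *v v + L *v (- v)))) (at x0)"
      unfolding \<Psi>_def
      by (intro has_derivative_add has_derivative_ident
          bounded_linear.has_derivative[OF matrix_vector_mul_bounded_linear] has_derivative_minus)
    then show ?thesis
      by (simp add: id_def flip: matrix_vector_right_distrib)
  qed
  ultimately obtain V V' g where V: "open V" "x0 \<in> V" "V \<subseteq> M" "open V'" "\<Psi> x0 \<in> V'"
    and hom: "homeomorphism V V' \<Psi> g" and g: "smooth_on V' g"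
    using smooth_local_inverse[OF M] by metis
  have gV: "g y \<in> V" "\<Psi> (g y) = y" if "y \<in> V'" for y
    using hom that unfolding homeomorphism_def by auto
  have sg: "s (g y) = L *v y" if "y \<in> V'" for y
    using L\<Psi>[of "g y"] gV[OF that] by simp
  obtain e where e: "e > 0" "ball (\<Psi> x0) e \<subseteq> V'"
    using V(4,5) open_contains_ball by blast
  let ?B = "ball (\<Psi> x0) e"
  define \<sigma> where "\<sigma> = (\<lambda>v. \<Psi> x0 + T *v (v + - s x0))"
  have L\<sigma>: "L *v \<sigma> v = v" for v
    by (simp add: \<sigma>_def matrix_vector_right_distrib LT L\<Psi>)
  have sm\<sigma>: "smooth_on A \<sigma>" if "open A" for A
    unfolding \<sigma>_def using that
    by (intro smooth_on_add smooth_on_const smooth_on_ident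
        smooth_on_linear[OF _ matrix_vector_mul_bounded_linear])
  define W where "W = \<sigma> -` ?B"
  have W: "open W"
    unfolding W_def by (intro open_vimage smooth_on_imp_continuous_on sm\<sigma>) simp_all
  have sx0: "s x0 \<in> W" using e by (simp add: W_def \<sigma>_def)
  define f where "f = (\<lambda>v. u (g (\<sigma> v)))"
  have ug: "smooth_on V' (\<lambda>y. u (g y))"
    by (rule smooth_on_compose[OF V(4) u g]) (use gV V(3) in blast)
  have f: "smooth_on W f"
    unfolding f_def by (rule smooth_on_compose[OF W ug sm\<sigma>[OF W]]) (use e in \<open>auto simp: W_def\<close>)
  have const: "u (g a) = u (g b)" if "a \<in> ?B" "b \<in> ?B" "L *v a = L *v b" for a b
  proof (rule constant_along_kernel[where B = ?B and L = L and h = "\<lambda>y. u (g y)"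
        and h' = "\<lambda>y w. frechet_derivative u (at (g y)) (frechet_derivative g (at y) w)"])
    fix y assume "y \<in> ?B"
    then have y: "y \<in> V'" using e by blast
    then have gy: "g y \<in> M" using gV V(3) by blast
    show "((\<lambda>y. u (g y)) has_derivative
        (\<lambda>w. frechet_derivative u (at (g y)) (frechet_derivative g (at y) w))) (at y)"
      by (rule has_derivative_compose[OF smooth_on_derivative[OF g y] smooth_on_derivative[OF u gy]])
    have "((\<lambda>y. s (g y)) has_derivative
        (\<lambda>w. frechet_derivative s (at (g y)) (frechet_derivative g (at y) w))) (at y)"
      by (rule has_derivative_compose[OF smooth_on_derivative[OF g y] smooth_on_derivative[OF s gy]])
    then have "((*v) L has_derivative
        (\<lambda>w. frechet_derivative s (at (g y)) (frechet_derivative g (at y) w))) (at y)"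
      using has_derivative_transform_within_open[OF _ V(4) y] sg by blast
    from has_derivative_unique[OF this bounded_linear_imp_has_derivative[OF matrix_vector_mul_bounded_linear]]
    have "frechet_derivative s (at (g y)) (frechet_derivative g (at y) w) = L *v w" for w
      by metis
    then show "frechet_derivative u (at (g y)) (frechet_derivative g (at y) w) = 0" if "L *v w = 0" for w
      using ker[OF gy] that by simp
  qed (use that in auto)
  have "continuous_on M \<Psi>" "continuous_on M s"
    using \<open>smooth_on M \<Psi>\<close> s by (auto intro: smooth_on_imp_continuous_on)
  then have "\<forall>\<^sub>F x in nhds x0. \<Psi> x \<in> ?B" "\<forall>\<^sub>F x in nhds x0. s x \<in> W"
    using e by (intro eventually_nhds_preimage[OF M] open_ball W sx0; simp)+
  moreover have "\<forall>\<^sub>F x in nhds x0. x \<in> V"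
    using V by (auto intro: eventually_nhds_in_open)
  ultimately have "\<forall>\<^sub>F x in nhds x0. s x \<in> W \<and> u x = f (s x)"
  proof eventually_elim
    case (elim x)
    have "u (g (\<Psi> x)) = u (g (\<sigma> (s x)))"
      using elim by (intro const) (auto simp: W_def L\<Psi> L\<sigma>)
    moreover have "g (\<Psi> x) = x" using hom elim(3) by (simp add: homeomorphism_def)
    ultimately show ?case using elim by (simp add: f_def)
  qed
  moreover have "f ` W \<subseteq> u ` M"
    using gV V(3) e by (force simp: f_def W_def)
  ultimately show thesis using that W sx0 f by blast
qed

section \<open>Riemann invariants along a function\<close>

definition wave_matrix :: "('k::finite \<Rightarrow> real^'q \<Rightarrow> real^'p) \<Rightarrow> real^'q \<Rightarrow> real^'p^'k" where
  "wave_matrix lam u = (\<chi> j. lam j u)"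

lemma riemann_invariants_eq: "riemann_invariants lam x u = wave_matrix lam u *v x"
  by (simp add: riemann_invariants_def wave_matrix_def matrix_vector_mult_def)

lemma riemann_invariants_nth: "riemann_invariants lam x u $ j = lam j u \<bullet> x"
  by (simp add: riemann_invariants_def inner_vec_def)

lemma riemann_invariants_0: "riemann_invariants lam 0 u = 0"
  by (simp add: riemann_invariants_eq)

text \<open>The family \<open>\<lambda>\<^sup>j(u)\<close> is injective, so a linear relation between the rows of the matrix is a linear
  relation on the set of these rows.\<close>

lemma wave_matrix_right_inverse:
  assumes "independent_family UNIV (\<lambda>j. lam j u)"
  shows "\<exists>T. wave_matrix lam u ** T = mat 1"
  unfolding matrix_right_invertible_independent_rows
proof (intro allI impI)
  fix c i
  assume eq: "(\<Sum>j\<in>UNIV. c j *s row j (wave_matrix lam u)) = 0"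
  let ?v = "\<lambda>j. lam j u"
  have inj: "inj ?v" and ind: "independent (range ?v)"
    using assms by (auto simp: independent_family_def)
  have "row j (wave_matrix lam u) = ?v j" for j
    by (simp add: row_def wave_matrix_def)
  then have "(\<Sum>j\<in>UNIV. c (inv ?v (?v j)) *\<^sub>R ?v j) = 0"
    using eq by (simp add: scalar_mult_eq_scaleR inv_f_f[OF inj])
  then have "(\<Sum>w\<in>range ?v. c (inv ?v w) *\<^sub>R w) = 0"
    by (simp add: sum.reindex[OF inj] o_def)
  then have "c (inv ?v (?v i)) = 0"
    by (intro real_vector.independentD[OF ind _ subset_refl, of "\<lambda>w. c (inv ?v w)"]) simp_all
  then show "c i = 0" by (simp only: inv_f_f[OF inj])
qed

lemma wave_matrix_mult_eq_0:
  assumes "\<And>j. (\<Sum>i\<in>UNIV. lam j u $ i * \<xi> $ i) = 0"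
  shows "wave_matrix lam u *v \<xi> = 0"
  using assms by (simp add: wave_matrix_def matrix_vector_mult_def vec_eq_iff)

lemma has_derivative_riemann_invariants:
  assumes "\<And>j. smooth_on U (lam j)" "u \<in> U"
  shows "(riemann_invariants lam x has_derivative
      (\<lambda>h. \<chi> j. (jacobian (lam j) (at u) *v h) \<bullet> x)) (at u)"
  by (rule has_derivative_vec) (auto simp: riemann_invariants_nth
      intro!: has_derivative_inner_left smooth_on_jacobian[OF assms])

lemma jacobian_riemann_invariants:
  assumes "\<And>j. smooth_on U (lam j)" "u \<in> U"
  shows "jacobian (riemann_invariants lam x) (at u) $ i $ \<alpha> =
    (\<Sum>m\<in>UNIV. jacobian (lam i) (at u) $ m $ \<alpha> * x $ m)"
  unfolding jacobian_nth[of "riemann_invariants lam x"]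
    frechet_derivative_at[OF has_derivative_riemann_invariants[OF assms], symmetric]
  by (simp add: inner_vec_def matrix_vector_mult_basis column_def)

text \<open>The product rule for \<open>\<Lambda>(u(x)) x\<close>.\<close>

lemma has_derivative_riemann_along:
  fixes lam :: "'k::finite \<Rightarrow> real^'q \<Rightarrow> real^'p"
  assumes "\<And>j. smooth_on U (lam j)" "u x \<in> U" and u: "(u has_derivative (*v) J) (at x)"
  shows "((\<lambda>x. riemann_invariants lam x (u x)) has_derivative
    (*v) (wave_matrix lam (u x) + jacobian (riemann_invariants lam x) (at (u x)) ** J)) (at x)"
proof -
  let ?R = "jacobian (riemann_invariants lam x) (at (u x))"
  note dR = has_derivative_riemann_invariants[where U = U and lam = lam and x = x, OF assms(1,2)]
  have R: "?R *v h = (\<chi> j. (jacobian (lam j) (at (u x)) *v h) \<bullet> x)" for h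
    using has_derivative_unique[OF jacobian_works[THEN iffD1, OF differentiableI[OF dR]] dR]
    by (rule fun_cong)
  show ?thesis
  proof (rule has_derivative_vec)
    fix j
    have "((\<lambda>x. lam j (u x)) has_derivative (\<lambda>v. jacobian (lam j) (at (u x)) *v (J *v v))) (at x)"
      by (rule has_derivative_compose[OF u smooth_on_jacobian[OF assms(1,2)]])
    from has_derivative_inner[OF this has_derivative_ident]
    show "((\<lambda>x. riemann_invariants lam x (u x) $ j) has_derivative
        (\<lambda>v. ((wave_matrix lam (u x) + ?R ** J) *v v) $ j)) (at x)"
      by (simp add: riemann_invariants_nth matrix_vector_mult_add_rdistrib R
          flip: matrix_vector_mul_assoc)
        (simp add: wave_matrix_def matrix_vector_mult_def inner_vec_def)
  qed
qed

lemma smooth_on_riemann_along: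
  fixes lam :: "'k::finite \<Rightarrow> real^'q \<Rightarrow> real^'p"
  assumes lam: "\<And>j. smooth_on U (lam j)" and u: "open N" "smooth_on N u" "u ` N \<subseteq> U"
  shows "smooth_on N (\<lambda>x. riemann_invariants lam x (u x))"
  by (rule smooth_on_vec[OF u(1)])
    (auto simp: riemann_invariants_nth intro!: smooth_on_bilinear[OF u(1) bounded_bilinear_inner]
      smooth_on_ident smooth_on_compose[OF u(1) lam u(2,3)] u(1))

section \<open>The derivative of an implicit solution\<close>

lemma phi_matrix_eq:
  "phi_matrix lam f u x = mat 1 - jacobian (riemann_invariants lam x) (at (u x)) **
     jacobian f (at (riemann_invariants lam x (u x)))"
  by (simp add: phi_matrix_def mat_def matrix_matrix_mult_def vec_eq_iff)

text \<open>Differentiating \<open>s(x) = r(x, u(x))\<close> and \<open>u = f \<circ> s\<close> gives two linear relations between the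
  Jacobian matrices of \<open>u\<close> and \<open>s\<close>. Eliminating the \<open>q \<times> p\<close> matrix first leads to the small system
  with matrix \<open>\<phi>\<close> for the derivative of \<open>s\<close>.\<close>

lemma implicit_solution_jacobian:
  fixes lam :: "'k::finite \<Rightarrow> real^'q \<Rightarrow> real^'p"
  assumes lam: "\<And>j. smooth_on U (lam j)" and f: "smooth_map_near0 W f U"
    and u: "implicit_solution lam U W f N u" and x: "x \<in> N"
    and inv: "invertible (phi_matrix lam f u x)"
  shows "jacobian u (at x) = jacobian f (at (riemann_invariants lam x (u x))) **
    (matrix_inv (phi_matrix lam f u x) ** wave_matrix lam (u x))"
proof -
  let ?s = "\<lambda>x. riemann_invariants lam x (u x)"
  let ?J = "jacobian u (at x)" and ?F = "jacobian f (at (?s x))"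
    and ?R = "jacobian (riemann_invariants lam x) (at (u x))" and ?L = "wave_matrix lam (u x)"
  let ?S = "?L + ?R ** ?J"
  have N: "open N" "smooth_on N u" "u x \<in> U" and s: "\<And>x. x \<in> N \<Longrightarrow> ?s x \<in> W \<and> f (?s x) = u x"
    using u x unfolding implicit_solution_def smooth_map_near0_def by auto
  have du: "(u has_derivative (*v) ?J) (at x)"
    by (rule smooth_on_jacobian[OF N(2) x])
  have "smooth_on W f" using f by (simp add: smooth_map_near0_def)
  then have "(f has_derivative (*v) ?F) (at (?s x))"
    using s[OF x] by (intro smooth_on_jacobian) auto
  from has_derivative_compose[OF has_derivative_riemann_along[OF lam N(3) du] this]
  have "((\<lambda>x. f (?s x)) has_derivative (\<lambda>v. ?F *v (?S *v v))) (at x)" .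
  then have "(u has_derivative (\<lambda>v. ?F *v (?S *v v))) (at x)"
    using has_derivative_transform_within_open[OF _ N(1) x] s by blast
  from has_derivative_unique[OF du this] have J: "?J = ?F ** ?S"
    by (simp add: matrix_eq matrix_vector_mul_assoc fun_eq_iff)
  have "phi_matrix lam f u x ** ?S = ?S - ?R ** (?F ** ?S)"
    by (simp add: matrix_eq phi_matrix_eq matrix_vector_mult_diff_rdistrib
        flip: matrix_vector_mul_assoc)
  also have "\<dots> = ?L" by (simp flip: J)
  finally have "?S = matrix_inv (phi_matrix lam f u x) ** ?L"
    using matrix_inv_mult[OF inv] by (metis matrix_mul_assoc matrix_mul_lid)
  with J show ?thesis by simp
qed

text \<open>At \<open>x = 0\<close> the derivative of \<open>r\<close> in \<open>u\<close> vanishes, so \<open>\<phi>\<close> is the identity there.\<close>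

lemma phi_matrix_invertible_near_0:
  fixes lam :: "'k::finite \<Rightarrow> real^'q \<Rightarrow> real^'p"
  assumes lam: "\<And>j. smooth_on U (lam j)" and f: "smooth_map_near0 W f U"
    and u: "implicit_solution lam U W f N u"
  shows "\<exists>M. open M \<and> 0 \<in> M \<and> M \<subseteq> N \<and> (\<forall>x\<in>M. invertible (phi_matrix lam f u x))"
proof -
  let ?s = "\<lambda>x. riemann_invariants lam x (u x)" and ?\<phi> = "phi_matrix lam f u"
  have N: "open N" "0 \<in> N" "smooth_on N u" "u ` N \<subseteq> U" and s: "?s ` N \<subseteq> W"
    and fW: "smooth_on W f"
    using u f unfolding implicit_solution_def smooth_map_near0_def by blast+
  have U: "u x \<in> U" if "x \<in> N" for x using N(4) that by blast
  have cu: "continuous_on N u" and cs: "continuous_on N ?s"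
    by (rule smooth_on_imp_continuous_on[OF N(3)])
      (rule smooth_on_imp_continuous_on[OF smooth_on_riemann_along[OF lam N(1,3,4)]])
  \<comment> \<open>on \<open>N\<close> this is \<open>\<phi>\<close>, written so that its continuity in \<open>x\<close> is visible\<close>
  define \<psi> where "\<psi> = (\<lambda>x. \<chi> i j. (if i = j then 1 else 0) - (\<Sum>\<alpha>\<in>UNIV.
      (\<Sum>m\<in>UNIV. jacobian (lam i) (at (u x)) $ m $ \<alpha> * x $ m) * jacobian f (at (?s x)) $ \<alpha> $ j))"
  have \<phi>: "?\<phi> x = \<psi> x" if "x \<in> N" for x
    by (simp add: phi_matrix_def \<psi>_def jacobian_riemann_invariants[OF lam U[OF that]])
  have dlam: "continuous_on N (\<lambda>x. jacobian (lam i) (at (u x)) $ m $ \<alpha>)" for i m \<alpha>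
    by (rule continuous_on_compose2[OF continuous_on_jacobian[OF lam] cu N(4)])
  have df: "continuous_on N (\<lambda>x. jacobian f (at (?s x)) $ \<alpha> $ j)" for \<alpha> j
    by (rule continuous_on_compose2[OF continuous_on_jacobian[OF fW] cs s])
  have "continuous_on N (\<lambda>x. \<psi> x $ i $ j)" for i j
    unfolding \<psi>_def vec_lambda_beta
    by (intro continuous_on_diff continuous_on_sum continuous_on_mult continuous_on_const
        continuous_on_component[OF continuous_on_id] dlam df)
  then have "open {x \<in> N. det (\<psi> x) \<noteq> 0}"
    by (intro open_det_nonzero N)
  moreover have "\<psi> 0 = mat 1" by (simp add: \<psi>_def mat_def)
  ultimately show ?thesis
    using N(2) \<phi> by (intro exI[of _ "{x \<in> N. det (\<psi> x) \<noteq> 0}"]) (auto simp: invertible_det_nz)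
qed

section \<open>Existence and uniqueness of the implicit solution\<close>

text \<open>The function \<open>g\<close> sends \<open>x\<close> to the straightened coordinate \<open>y = x + T (s - L x)\<close> of the solution,
  from which \<open>s = L y\<close> is recovered. The equation \<open>s = r(x, f(s))\<close> becomes \<open>B(y) x = y\<close>: solving it for
  \<open>x\<close> is linear algebra, and only then is the inverse function theorem applied. The last conclusion
  is the local uniqueness of \<open>s\<close>; it holds as long as the straightened coordinate stays in \<open>V\<close>.\<close>

lemma implicit_riemann_coordinates:
  fixes lam :: "'k::finite \<Rightarrow> real^'q \<Rightarrow> real^'p" and T :: "real^'k^'p" and L :: "real^'p^'k"
  assumes lam: "\<And>j. smooth_on U (lam j)" and f: "smooth_map_near0 W f U"
    and L: "L = wave_matrix lam (f 0)" and T: "L ** T = mat 1"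
  obtains V N g where "open V" "0 \<in> V" "open N" "0 \<in> N" "smooth_on N g"
    "\<And>x. x \<in> N \<Longrightarrow> L *v g x \<in> W"
    "\<And>x. x \<in> N \<Longrightarrow> riemann_invariants lam x (f (L *v g x)) = L *v g x"
    "\<And>x s. s = riemann_invariants lam x (f s) \<Longrightarrow> x + T *v (s - L *v x) \<in> V \<Longrightarrow> s = L *v g x"
proof -
  have LT: "L *v (T *v v) = v" for v
    using T by (simp add: matrix_vector_mul_assoc)
  have W: "open W" "0 \<in> W" and fs: "smooth_on W f" and fU: "f ` W \<subseteq> U"
    using f by (auto simp: smooth_map_near0_def)
  define C where "C = (\<lambda>y. wave_matrix lam (f (L *v y)))"
  define B where "B = (\<lambda>y. mat 1 + T ** (C y - L))"
  have B: "B y *v x = x + T *v (C y *v x - L *v x)" for y x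
    by (simp add: B_def matrix_vector_mult_add_rdistrib matrix_vector_mult_diff_rdistrib
        flip: matrix_vector_mul_assoc)
  have LB: "L *v (B y *v x) = C y *v x" for y x
    by (simp add: B matrix_vector_right_distrib LT)
  have B0: "B 0 = mat 1" by (simp add: B_def C_def L)
  define S0 where "S0 = (*v) L -` W"
  have S0: "open S0"
    unfolding S0_def using W(1)
    by (intro open_vimage linear_continuous_on matrix_vector_mul_bounded_linear)
  have smB: "smooth_on S0 (\<lambda>y. B y $ i $ j)" for i j
  proof -
    have "smooth_on S0 (\<lambda>y. f (L *v y))"
      using smooth_on_linear[OF S0 matrix_vector_mul_bounded_linear smooth_on_ident[OF S0], of L]
      by (rule smooth_on_compose[OF S0 fs]) (auto simp: S0_def)
    then have "smooth_on S0 (\<lambda>y. lam k (f (L *v y)))" for k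
      by (rule smooth_on_compose[OF S0 lam]) (use fU in \<open>auto simp: S0_def\<close>)
    then have "smooth_on S0 (\<lambda>y. mat 1 $ i $ j + (\<Sum>k\<in>UNIV. T $ i $ k * (lam k (f (L *v y)) $ j + - L $ k $ j)))"
      by (intro smooth_on_add smooth_on_sum smooth_on_const S0
          smooth_on_linear[OF S0 bounded_linear_mult_right] smooth_on_linear[OF S0 bounded_linear_vec_nth])
    then show ?thesis by (simp add: B_def C_def wave_matrix_def matrix_matrix_mult_def)
  qed
  define S where "S = {y \<in> S0. det (B y) \<noteq> 0}"
  have S: "open S" unfolding S_def by (intro open_det_nonzero S0 smooth_on_imp_continuous_on smB)
  have S_0: "0 \<in> S" using W(2) by (simp add: S_def S0_def B0)
  have SS: "S \<subseteq> S0" by (auto simp: S_def)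
  define H where "H = (\<lambda>y. matrix_inv (B y) *v y)"
  have BH: "B y *v H y = y" if "y \<in> S" for y
    using that matrix_inv_mult_right[of "B y"]
    by (simp add: H_def S_def invertible_det_nz matrix_vector_mul_assoc)
  have HB: "H y = x" if "y \<in> S" "B y *v x = y" for x y
  proof -
    have "matrix_inv (B y) *v (B y *v x) = x"
      using that(1) by (simp add: S_def invertible_det_nz matrix_vector_mul_assoc matrix_inv_mult)
    with that(2) show ?thesis by (simp add: H_def)
  qed
  have H0: "H 0 = 0" by (simp add: H_def)
  have smH: "smooth_on S H"
    by (rule smooth_on_linear_system[OF S smooth_on_subset[OF smB SS] smooth_on_ident[OF S]])
      (auto simp: S_def BH)
  let ?H' = "frechet_derivative H (at 0)"
  have H': "(H has_derivative ?H') (at 0)" by (rule smooth_on_derivative[OF smH S_0])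
  \<comment> \<open>differentiate \<open>B(y) H(y) = y\<close> at \<open>0\<close>, where \<open>B = 1\<close> and \<open>H = 0\<close>\<close>
  have "?H' v $ i = v $ i" for v i
  proof -
    let ?b = "\<lambda>j. frechet_derivative (\<lambda>y. B y $ i $ j) (at 0)"
    have "((\<lambda>y. \<Sum>j\<in>UNIV. B y $ i $ j * H y $ j) has_derivative
        (\<lambda>v. \<Sum>j\<in>UNIV. B 0 $ i $ j * ?H' v $ j + ?b j v * H 0 $ j)) (at 0)"
      by (intro has_derivative_sum has_derivative_mult
          bounded_linear.has_derivative[OF bounded_linear_vec_nth H']
          smooth_on_derivative[OF smB]) (use S_0 SS in auto)
    moreover have "(\<Sum>j\<in>UNIV. B 0 $ i $ j * ?H' v $ j + ?b j v * H 0 $ j) = ?H' v $ i" for v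
      by (simp add: B0 H0 mat_def if_distrib[of "\<lambda>x. x * _"] cong: if_cong)
    ultimately have "((\<lambda>y. \<Sum>j\<in>UNIV. B y $ i $ j * H y $ j) has_derivative (\<lambda>v. ?H' v $ i)) (at 0)"
      by simp
    moreover have "(\<Sum>j\<in>UNIV. B y $ i $ j * H y $ j) = y $ i" if "y \<in> S" for y
      using BH[OF that] by (simp add: matrix_vector_mult_def vec_eq_iff)
    ultimately have "((\<lambda>y. y $ i) has_derivative (\<lambda>v. ?H' v $ i)) (at 0)"
      by (rule has_derivative_transform_within_open[OF _ S S_0])
    from has_derivative_unique[OF this
        bounded_linear_imp_has_derivative[OF bounded_linear_vec_nth]]
    show ?thesis by metis
  qed
  then have "?H' = id" by (simp add: fun_eq_iff vec_eq_iff)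
  with H' obtain V N g where V: "open V" "0 \<in> V" "V \<subseteq> S" and N: "open N" "0 \<in> N"
    and hom: "homeomorphism V N H g" and g: "smooth_on N g"
    using smooth_local_inverse[OF S S_0 smH] H0 by metis
  have gV: "g x \<in> V" "H (g x) = x" if "x \<in> N" for x
    using hom that unfolding homeomorphism_def by auto
  show thesis
  proof (rule that[OF V(1,2) N g])
    fix x assume x: "x \<in> N"
    have gS: "g x \<in> S" using gV(1)[OF x] V(3) by blast
    show "L *v g x \<in> W" using gS SS by (auto simp: S0_def)
    have "L *v g x = C (g x) *v x"
      using LB[of "g x" x] BH[OF gS] gV(2)[OF x] by simp
    then show "riemann_invariants lam x (f (L *v g x)) = L *v g x"
      by (simp add: riemann_invariants_eq C_def)
  next
    fix x s assume s: "s = riemann_invariants lam x (f s)" and y: "x + T *v (s - L *v x) \<in> V"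
    let ?y = "x + T *v (s - L *v x)"
    have Ly: "L *v ?y = s" by (simp add: matrix_vector_right_distrib LT)
    then have "C ?y *v x = s" using s[symmetric] by (simp add: C_def riemann_invariants_eq)
    then have "B ?y *v x = ?y" by (simp add: B)
    then have "H ?y = x" using HB V(3) y by blast
    then have "g x = ?y" using hom y by (metis homeomorphism_def)
    then show "s = L *v g x" using Ly by simp
  qed
qed

lemma implicit_solution_exists:
  fixes lam :: "'k::finite \<Rightarrow> real^'q \<Rightarrow> real^'p"
  assumes lam: "\<And>j. smooth_on U (lam j)" and f: "smooth_map_near0 W f U"
    and ind: "independent_family UNIV (\<lambda>j. lam j (f 0))"
  shows "\<exists>N u. implicit_solution lam U W f N u"
proof -
  define L where "L = wave_matrix lam (f 0)"
  obtain T where "L ** T = mat 1" using wave_matrix_right_inverse[of lam, OF ind] L_def by blast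
  from implicit_riemann_coordinates[OF lam f L_def this]
  obtain N g where N: "open N" "0 \<in> N" "smooth_on N g" and W: "\<And>x. x \<in> N \<Longrightarrow> L *v g x \<in> W"
    and r: "\<And>x. x \<in> N \<Longrightarrow> riemann_invariants lam x (f (L *v g x)) = L *v g x"
    by metis
  have fW: "smooth_on W f" "f ` W \<subseteq> U" using f by (auto simp: smooth_map_near0_def)
  have "smooth_on N (\<lambda>x. f (L *v g x))"
    using smooth_on_linear[OF N(1) matrix_vector_mul_bounded_linear N(3), of L]
    by (rule smooth_on_compose[OF N(1) fW(1)]) (use W in auto)
  then have "implicit_solution lam U W f N (\<lambda>x. f (L *v g x))"
    using N W r fW unfolding implicit_solution_def smooth_map_near0_def by auto
  then show ?thesis by blast
qed

text \<open>Any two solutions have straightened coordinates that are continuous and vanish at \<open>0\<close>, hence lie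
  in the region of local uniqueness for small \<open>x\<close>.\<close>

lemma implicit_solution_unique:
  fixes lam :: "'k::finite \<Rightarrow> real^'q \<Rightarrow> real^'p"
  assumes lam: "\<And>j. smooth_on U (lam j)" and f: "smooth_map_near0 W f U"
    and ind: "independent_family UNIV (\<lambda>j. lam j (f 0))"
    and u: "implicit_solution lam U W f N u" "implicit_solution lam U W f N' u'"
  shows "\<forall>\<^sub>F x in nhds 0. u x = u' x"
proof -
  define L where "L = wave_matrix lam (f 0)"
  obtain T where "L ** T = mat 1" using wave_matrix_right_inverse[of lam, OF ind] L_def by blast
  from implicit_riemann_coordinates[OF lam f L_def this]
  obtain V g where V: "open V" "0 \<in> V"
    and uniq: "\<And>x s. s = riemann_invariants lam x (f s) \<Longrightarrow> x + T *v (s - L *v x) \<in> V \<Longrightarrow> s = L *v g x"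
    by metis
  have "\<forall>\<^sub>F x in nhds 0. v x = f (L *v g x)" if v: "implicit_solution lam U W f M v" for M v
  proof -
    let ?s = "\<lambda>x. riemann_invariants lam x (v x)" and ?y = "\<lambda>x. x + T *v (riemann_invariants lam x (v x) - L *v x)"
    have M: "open M" "0 \<in> M" "smooth_on M v" "v ` M \<subseteq> U"
      and s: "\<And>x. x \<in> M \<Longrightarrow> v x = f (?s x)"
      using v unfolding implicit_solution_def smooth_map_near0_def by blast+
    have "continuous_on M ?s"
      by (rule smooth_on_imp_continuous_on[OF smooth_on_riemann_along[OF lam M(1,3,4)]])
    then have "continuous_on M ?y"
      by (intro continuous_on_add continuous_on_diff continuous_on_id
          bounded_linear.continuous_on[OF matrix_vector_mul_bounded_linear])
    moreover have "?y 0 \<in> V" using V(2) by (simp add: riemann_invariants_0)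
    ultimately have "\<forall>\<^sub>F x in nhds 0. ?y x \<in> V"
      by (intro eventually_nhds_preimage[OF M(1,2) _ V(1)])
    moreover have "\<forall>\<^sub>F x in nhds 0. x \<in> M" using M by (auto intro: eventually_nhds_in_open)
    ultimately show ?thesis
    proof eventually_elim
      case (elim x)
      have "?s x = riemann_invariants lam x (f (?s x))" by (simp only: s[OF elim(2), symmetric])
      from uniq[OF this elim(1)] s[OF elim(2)] show ?case by metis
    qed
  qed
  from this[OF u(1)] this[OF u(2)] show ?thesis by eventually_elim simp
qed

section \<open>Graphs invariant under the horizontal fields\<close>

text \<open>The second component of a curve in the graph is \<open>u\<close> applied to the first one, so the chain rule
  determines the vertical part of a tangent vector from its horizontal part \<open>v\<close>. Conversely, a
  vector \<open>(v, 0)\<close> with \<open>Du(x) v = 0\<close> is the velocity of the lift of the line \<open>t \<mapsto> x + t v\<close>.\<close>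

lemma invariant_under_horizontal_field_iff:
  fixes u :: "real^'p \<Rightarrow> real^'q"
  assumes M: "open M" and u: "smooth_on M u"
  shows "invariant_under (horizontal_field \<xi>) (graph_over M u) \<longleftrightarrow>
    (\<forall>x\<in>M. frechet_derivative u (at x) (\<xi> (u x)) = 0)"
proof -
  let ?G = "graph_over M u"
  have "(v, 0) \<in> tangent_vectors ?G (x, u x) \<longleftrightarrow> frechet_derivative u (at x) v = 0"
    if x: "x \<in> M" for x v
  proof
    assume "(v, 0) \<in> tangent_vectors ?G (x, u x)"
    then obtain e \<gamma> where e: "e > 0" and sub: "\<gamma> ` {-e<..<e} \<subseteq> ?G" and \<gamma>0: "\<gamma> 0 = (x, u x)"
      and der: "(\<gamma> has_vector_derivative (v, 0)) (at (0::real))"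
      unfolding tangent_vectors_def by blast
    have der: "(\<gamma> has_derivative (\<lambda>t. t *\<^sub>R (v, 0))) (at 0)"
      using der by (simp add: has_vector_derivative_def)
    have der1: "((\<lambda>t. fst (\<gamma> t)) has_derivative (\<lambda>t. t *\<^sub>R v)) (at 0)"
      and der2: "((\<lambda>t. snd (\<gamma> t)) has_derivative (\<lambda>t. 0)) (at 0)"
      using has_derivative_fst[OF der] has_derivative_snd[OF der] by simp_all
    have "((\<lambda>t. u (fst (\<gamma> t))) has_derivative (\<lambda>t. frechet_derivative u (at x) (t *\<^sub>R v))) (at 0)"
      using has_derivative_compose[OF der1, of u] smooth_on_derivative[OF u x] \<gamma>0 by simp
    moreover have "u (fst (\<gamma> t)) = snd (\<gamma> t)" if "t \<in> {-e<..<e}" for t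
      using that sub by (force simp: graph_over_def)
    ultimately have "((\<lambda>t. snd (\<gamma> t)) has_derivative (\<lambda>t. frechet_derivative u (at x) (t *\<^sub>R v))) (at 0)"
      using has_derivative_transform_within_open[OF _ open_greaterThanLessThan, of _ _ 0 UNIV "-e" e] e
      by fastforce
    from has_derivative_unique[OF this der2] have "frechet_derivative u (at x) (1 *\<^sub>R v) = 0"
      by metis
    then show "frechet_derivative u (at x) v = 0" by simp
  next
    assume 0: "frechet_derivative u (at x) v = 0"
    let ?c = "\<lambda>t::real. x + t *\<^sub>R v"
    let ?\<gamma> = "\<lambda>t. (?c t, 0) + (0, u (?c t))"
    have "open (?c -` M)"
      using M by (intro open_vimage continuous_intros)
    then obtain e where e: "e > 0" "ball 0 e \<subseteq> ?c -` M"
      using x open_contains_ball[of "?c -` M"] by (auto dest!: bspec[of _ _ 0])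
    let ?I = "{-e<..<e}"
    have I: "?c ` ?I \<subseteq> M" using e(2) by (force simp: ball_def dist_real_def)
    have c: "smooth_on A ?c" if "open A" for A
      using that by (intro smooth_on_add smooth_on_const smooth_on_linear[OF _ bounded_linear_scaleR_left] smooth_on_ident)
    have "smooth_on ?I ?\<gamma>"
      by (intro smooth_on_add
          smooth_on_linear[OF _ bounded_linear_Pair[OF bounded_linear_ident bounded_linear_zero]]
          smooth_on_linear[OF _ bounded_linear_Pair[OF bounded_linear_zero bounded_linear_ident]]
          smooth_on_compose[OF _ u c I] c) auto
    moreover have "?\<gamma> ` ?I \<subseteq> ?G" using I by (auto simp: graph_over_def)
    moreover have "(?\<gamma> has_vector_derivative (v, 0)) (at 0)"
    proof -
      have c': "(?c has_derivative (\<lambda>t. t *\<^sub>R v)) (at 0)"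
        by (auto intro!: derivative_eq_intros)
      have "((\<lambda>t. u (?c t)) has_derivative (\<lambda>t. frechet_derivative u (at x) (t *\<^sub>R v))) (at 0)"
        using has_derivative_compose[OF c', of u] smooth_on_derivative[OF u x] by simp
      moreover have "frechet_derivative u (at x) (t *\<^sub>R v) = 0" for t
        using 0 has_derivative_linear[OF smooth_on_derivative[OF u x]] by (simp add: linear_scale)
      ultimately have "((\<lambda>t. u (?c t)) has_derivative (\<lambda>t. 0)) (at 0)" by simp
      from has_derivative_Pair[OF c' this] show ?thesis
        by (simp add: has_vector_derivative_def)
    qed
    ultimately show "(v, 0) \<in> tangent_vectors ?G (x, u x)"
      unfolding tangent_vectors_def using e(1) by (auto intro!: exI[of _ e] exI[of _ ?\<gamma>])
  qed
  then show ?thesis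
    unfolding invariant_under_def horizontal_field_def by (auto simp: graph_over_def)
qed

text \<open>The kernel of a surjective \<open>D\<close> is orthogonal to its row space, which has dimension \<open>k\<close>; so
  \<open>p - k\<close> independent vectors in the kernel span it.\<close>

lemma kernel_subset_span:
  fixes D :: "real^'p^'k"
  assumes surj: "surj ((*v) D)" and ind: "independent_family {..<CARD('p) - CARD('k)} \<xi>"
    and ker: "\<And>a. a < CARD('p) - CARD('k) \<Longrightarrow> D *v \<xi> a = 0" and v: "D *v v = 0"
  shows "v \<in> span (\<xi> ` {..<CARD('p) - CARD('k)})"
proof -
  let ?K = "{v. D *v v = 0}" and ?X = "\<xi> ` {..<CARD('p) - CARD('k)}"
  have "?K \<subseteq> {y \<in> UNIV. \<forall>x \<in> span (rows D). orthogonal x y}"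
    using orthogonal_nullspace_rowspace by (auto simp: orthogonal_commute)
  then have "dim ?K + dim (span (rows D)) \<le> dim (UNIV :: (real^'p) set)"
    using dim_subset[of ?K] dim_subspace_orthogonal_to_vectors[of "span (rows D)" UNIV]
    by (metis (no_types, lifting) add_le_cancel_right subspace_span subspace_UNIV subset_UNIV)
  moreover have "dim (span (rows D)) = CARD('k)"
    using surj by (simp add: full_rank_surjective[symmetric] row_rank_def)
  ultimately have "dim ?K \<le> card ?X"
    using ind by (simp add: independent_family_def card_image)
  then have "?K \<subseteq> span ?X"
    using ind ker by (intro card_ge_dim_independent) (auto simp: independent_family_def)
  then show ?thesis using v by blast
qed

text \<open>The hypothesis \<open>Du(x) \<xi>\<^sub>a(u(x)) = 0\<close> makes the second term of \<open>Ds = \<Lambda> + R Du\<close> vanish on \<open>\<xi>\<^sub>a\<close>, and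
  the first one vanishes there by assumption. Near \<open>0\<close> the matrix \<open>Ds\<close> is still surjective, so the
  \<open>\<xi>\<^sub>a\<close> span its kernel, which therefore lies in the kernel of \<open>Du\<close>.\<close>

lemma invariant_graph_locally_factors:
  fixes lam :: "'k::finite \<Rightarrow> real^'q \<Rightarrow> real^'p"
  assumes lam: "\<And>j. smooth_on U (lam j)"
    and ind: "\<And>u. u \<in> U \<Longrightarrow> independent_family UNIV (\<lambda>j. lam j u)"
    and xi: "\<And>u. u \<in> U \<Longrightarrow> independent_family {..<CARD('p) - CARD('k)} (\<lambda>a. \<xi> a u)"
    and ann: "\<And>u a. u \<in> U \<Longrightarrow> a < CARD('p) - CARD('k) \<Longrightarrow> wave_matrix lam u *v \<xi> a u = 0"
    and M: "open M" "0 \<in> M" "smooth_on M u" "u ` M \<subseteq> U"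
    and inv: "\<And>x a. x \<in> M \<Longrightarrow> a < CARD('p) - CARD('k) \<Longrightarrow> jacobian u (at x) *v \<xi> a (u x) = 0"
  shows "\<exists>W f. smooth_map_near0 W f U \<and>
    (\<forall>\<^sub>F x in nhds 0. riemann_invariants lam x (u x) \<in> W \<and> u x = f (riemann_invariants lam x (u x)))"
proof -
  let ?s = "\<lambda>x. riemann_invariants lam x (u x)" and ?n = "CARD('p) - CARD('k)"
  have U: "u x \<in> U" if "x \<in> M" for x using M(4) that by blast
  have ds: "jacobian ?s (at x) = wave_matrix lam (u x) +
      jacobian (riemann_invariants lam x) (at (u x)) ** jacobian u (at x)" if "x \<in> M" for x
  proof -
    note d = has_derivative_riemann_along[OF lam U[OF that] smooth_on_jacobian[OF M(3) that]]
    have "(*v) (jacobian ?s (at x)) = (*v) (wave_matrix lam (u x) +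
      jacobian (riemann_invariants lam x) (at (u x)) ** jacobian u (at x))"
      by (rule has_derivative_unique[OF jacobian_works[THEN iffD1, OF differentiableI[OF d]] d])
    then show ?thesis by (simp add: matrix_eq fun_eq_iff)
  qed
  have "jacobian (riemann_invariants lam 0) (at (u 0)) = 0"
    by (simp add: vec_eq_iff jacobian_riemann_invariants[OF lam U[OF M(2)]])
  then have ds0: "jacobian ?s (at 0) = wave_matrix lam (u 0)"
    by (simp add: ds[OF M(2)])
  obtain T where T: "jacobian ?s (at 0) ** T = mat 1"
    using wave_matrix_right_inverse[of lam, OF ind[OF U[OF M(2)]]] unfolding ds0 by (rule exE)
  have s: "smooth_on M ?s" by (rule smooth_on_riemann_along[OF lam M(1,3,4)])
  \<comment> \<open>invertibility of \<open>Ds(x) T\<close> witnesses surjectivity of \<open>Ds(x)\<close> and is an open condition\<close>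
  define D where "D = (\<lambda>x. jacobian ?s (at x) ** T)"
  define M' where "M' = {x \<in> M. det (D x) \<noteq> 0}"
  have "continuous_on M (\<lambda>x. D x $ i $ j)" for i j
  proof -
    have "continuous_on M (\<lambda>x. \<Sum>k\<in>UNIV. jacobian ?s (at x) $ i $ k * T $ k $ j)"
      using continuous_on_jacobian[OF s]
      by (intro continuous_on_sum continuous_on_mult_right) blast
    then show ?thesis by (simp add: D_def matrix_matrix_mult_def)
  qed
  then have M': "open M'"
    unfolding M'_def by (intro open_det_nonzero M(1))
  have M'0: "0 \<in> M'" using M(2) T by (simp add: M'_def D_def)
  have sub: "M' \<subseteq> M" by (auto simp: M'_def)
  have ker: "frechet_derivative u (at x) v = 0"
    if x: "x \<in> M'" and v: "frechet_derivative ?s (at x) v = 0" for x v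
  proof -
    have xM: "x \<in> M" using x sub by blast
    have frechet: "frechet_derivative h (at x) = (*v) (jacobian h (at x))" if "smooth_on M h"
      for h :: "real^'p \<Rightarrow> real^'m"
      by (rule frechet_derivative_at[OF smooth_on_jacobian[OF that xM], symmetric])
    have "surj ((*v) (jacobian ?s (at x)))"
    proof -
      have "det (D x) \<noteq> 0" using x unfolding M'_def by (rule CollectE) (erule conjunct2)
      then have "D x ** matrix_inv (D x) = mat 1"
        by (intro matrix_inv_mult_right) (simp only: invertible_det_nz not_False_eq_True)
      then have "jacobian ?s (at x) ** (T ** matrix_inv (D x)) = mat 1"
        unfolding matrix_mul_assoc D_def .
      then show ?thesis by (intro matrix_right_invertible_surjective[THEN iffD1] exI)
    qed
    then have "v \<in> span ((\<lambda>a. \<xi> a (u x)) ` {..<?n})"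
    proof (rule kernel_subset_span[OF _ xi[OF U[OF xM]]])
      show "jacobian ?s (at x) *v \<xi> a (u x) = 0" if "a < ?n" for a
        using inv[OF xM that] ann[OF U[OF xM] that]
        by (simp add: ds[OF xM] matrix_vector_mult_add_rdistrib flip: matrix_vector_mul_assoc)
      show "jacobian ?s (at x) *v v = 0" using v frechet[OF s] by simp
    qed
    moreover have "jacobian u (at x) *v w = 0" if "w \<in> (\<lambda>a. \<xi> a (u x)) ` {..<?n}" for w
      using that inv[OF xM] by blast
    ultimately have "jacobian u (at x) *v v = 0"
      by (rule linear_eq_0_on_span[OF matrix_vector_mul_linear, rotated])
    then show ?thesis by (simp add: frechet[OF M(3)])
  qed
  obtain W f where W: "open W" "?s 0 \<in> W" "smooth_on W f" "f ` W \<subseteq> u ` M'"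
    and ev: "\<forall>\<^sub>F x in nhds 0. ?s x \<in> W \<and> u x = f (?s x)"
    by (rule locally_factors_through_submersion[OF M' M'0 smooth_on_subset[OF s sub]
          smooth_on_subset[OF M(3) sub] T ker])
  have "f ` W \<subseteq> U" using W(4) M(4) sub by blast
  then have "smooth_map_near0 W f U"
    using W by (simp add: smooth_map_near0_def riemann_invariants_0)
  from conjI[OF this ev] show ?thesis by (intro exI)
qed

section \<open>The solutions of rank at most k\<close>

theorem mainTheorem1:
  fixes U :: "(real^'q) set"
    and A :: "'p::finite \<Rightarrow> real^'q \<Rightarrow> real^'q^'q"
    and lam :: "'k::finite \<Rightarrow> real^'q \<Rightarrow> real^'p"
    and \<xi> :: "nat \<Rightarrow> real^'q \<Rightarrow> real^'p"
  assumes k_le_p: "CARD('k) \<le> CARD('p)"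
    and U_open: "open U"
    and A_smooth: "\<And>i. smooth_on U (A i)"
    and lam_smooth: "\<And>j. smooth_on U (lam j)"
    and lam_wave: "\<And>j. wave_vector U A (lam j)"
    and lam_indep: "\<And>u. u \<in> U \<Longrightarrow> independent_family UNIV (\<lambda>j. lam j u)"
    and xi_smooth: "\<And>a. a < CARD('p) - CARD('k) \<Longrightarrow> smooth_on U (\<xi> a)"
    and xi_indep: "\<And>u. u \<in> U \<Longrightarrow> independent_family {..<CARD('p) - CARD('k)} (\<lambda>a. \<xi> a u)"
    and xi_annihilated: "\<And>u j a. u \<in> U \<Longrightarrow> a < CARD('p) - CARD('k) \<Longrightarrow>
                           (\<Sum>i\<in>UNIV. lam j u $ i * \<xi> a u $ i) = 0"
  shows
    "(\<forall>W f. smooth_map_near0 W f U \<longrightarrow>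
        (\<exists>N u. implicit_solution lam U W f N u) \<and>
        (\<forall>N\<^sub>1 u\<^sub>1 N\<^sub>2 u\<^sub>2. implicit_solution lam U W f N\<^sub>1 u\<^sub>1 \<longrightarrow> implicit_solution lam U W f N\<^sub>2 u\<^sub>2 \<longrightarrow>
           (\<forall>\<^sub>F x in nhds 0. u\<^sub>1 x = u\<^sub>2 x)) \<and>
        (\<forall>N u. implicit_solution lam U W f N u \<longrightarrow>
           (\<forall>x\<in>N. \<forall>i \<alpha>. jacobian (riemann_invariants lam x) (at (u x)) $ i $ \<alpha> =
                          (\<Sum>m\<in>UNIV. jacobian (lam i) (at (u x)) $ m $ \<alpha> * x $ m)) \<and>
           (\<exists>M. open M \<and> 0 \<in> M \<and> M \<subseteq> N \<and> (\<forall>x\<in>M. invertible (phi_matrix lam f u x))) \<and>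
           (\<forall>M. open M \<and> 0 \<in> M \<and> M \<subseteq> N \<and> (\<forall>x\<in>M. invertible (phi_matrix lam f u x)) \<longrightarrow>
              (\<forall>x\<in>M.
                 (\<forall>i \<alpha>. jacobian u (at x) $ \<alpha> $ i =
                    (\<Sum>l\<in>UNIV. \<Sum>j\<in>UNIV. matrix_inv (phi_matrix lam f u x) $ l $ j *
                       lam j (u x) $ i *
                       jacobian f (at (riemann_invariants lam x (u x))) $ \<alpha> $ l)) \<and>
                 rank (jacobian u (at x)) \<le> CARD('k)))))
     \<and>
     (\<forall>N u. smooth_map_near0 N u U \<longrightarrow>
        ((\<exists>W f. smooth_map_near0 W f U \<and>
            (\<forall>\<^sub>F x in nhds 0. riemann_invariants lam x (u x) \<in> W \<and>
                             u x = f (riemann_invariants lam x (u x))))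
         \<longleftrightarrow>
         (\<exists>M. open M \<and> 0 \<in> M \<and> M \<subseteq> N \<and>
            (\<forall>a < CARD('p) - CARD('k).
               invariant_under (horizontal_field (\<xi> a)) (graph_over M u)))))
     \<and>
     (\<forall>W f N u. smooth_map_near0 W f U \<longrightarrow> implicit_solution lam U W f N u \<longrightarrow>
        (\<forall>M. open M \<and> 0 \<in> M \<and> M \<subseteq> N \<and> (\<forall>x\<in>M. invertible (phi_matrix lam f u x)) \<longrightarrow>
           (quasilinear_solution_on M A u
            \<longleftrightarrow>
            (\<forall>x\<in>M. (\<Sum>i\<in>UNIV. \<Sum>l\<in>UNIV. \<Sum>j\<in>UNIV.
               (matrix_inv (phi_matrix lam f u x) $ l $ j * lam j (u x) $ i) *\<^sub>R
                 (A i (u x) *v column l (jacobian f (at (riemann_invariants lam x (u x)))))) = 0))))"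
proof (intro conjI allI impI ballI)
  let ?n = "CARD('p) - CARD('k)"
  have ann: "wave_matrix lam u *v \<xi> a u = 0" if "u \<in> U" "a < ?n" for u a
    using xi_annihilated[OF that] by (rule wave_matrix_mult_eq_0)
  have ind0: "independent_family UNIV (\<lambda>j. lam j (f 0))"
    if "smooth_map_near0 W f U" for W and f :: "real^'k \<Rightarrow> real^'q"
    using that by (intro lam_indep) (auto simp: smooth_map_near0_def)
  have entry: "jacobian u (at x) $ \<alpha> $ i = (\<Sum>l\<in>UNIV. \<Sum>j\<in>UNIV.
      matrix_inv (phi_matrix lam f u x) $ l $ j * lam j (u x) $ i *
      jacobian f (at (riemann_invariants lam x (u x))) $ \<alpha> $ l)"
    if "smooth_map_near0 W f U" "implicit_solution lam U W f N u" "x \<in> N"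
      "invertible (phi_matrix lam f u x)" for W f N x \<alpha> i and u :: "real^'p \<Rightarrow> real^'q"
    unfolding implicit_solution_jacobian[OF lam_smooth that]
    by (simp add: matrix_matrix_mult_def wave_matrix_def sum_distrib_right sum_distrib_left mult_ac)
  {
    fix W and f :: "real^'k \<Rightarrow> real^'q"
    assume f: "smooth_map_near0 W f U"
    show "\<exists>N u. implicit_solution lam U W f N u"
      by (rule implicit_solution_exists[OF lam_smooth f ind0[OF f]])
    show "\<forall>\<^sub>F x in nhds 0. u\<^sub>1 x = u\<^sub>2 x"
      if "implicit_solution lam U W f N\<^sub>1 u\<^sub>1" "implicit_solution lam U W f N\<^sub>2 u\<^sub>2" for N\<^sub>1 u\<^sub>1 N\<^sub>2 u\<^sub>2
      by (rule implicit_solution_unique[OF lam_smooth f ind0[OF f] that])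
    fix N u assume u: "implicit_solution lam U W f N u"
    show "jacobian (riemann_invariants lam x) (at (u x)) $ i $ \<alpha> =
        (\<Sum>m\<in>UNIV. jacobian (lam i) (at (u x)) $ m $ \<alpha> * x $ m)" if "x \<in> N" for x i \<alpha>
    proof (rule jacobian_riemann_invariants[OF lam_smooth])
      have "smooth_map_near0 N u U" using u unfolding implicit_solution_def by (rule conjunct1)
      then show "u x \<in> U" using that by (auto simp: smooth_map_near0_def)
    qed
    show "\<exists>M. open M \<and> 0 \<in> M \<and> M \<subseteq> N \<and> (\<forall>x\<in>M. invertible (phi_matrix lam f u x))"
      by (rule phi_matrix_invertible_near_0[OF lam_smooth f u])
    fix M assume M: "open M \<and> 0 \<in> M \<and> M \<subseteq> N \<and> (\<forall>x\<in>M. invertible (phi_matrix lam f u x))"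
    fix x assume "x \<in> M"
    with M have x: "x \<in> N" "invertible (phi_matrix lam f u x)" by auto
    show "jacobian u (at x) $ \<alpha> $ i = (\<Sum>l\<in>UNIV. \<Sum>j\<in>UNIV.
        matrix_inv (phi_matrix lam f u x) $ l $ j * lam j (u x) $ i *
        jacobian f (at (riemann_invariants lam x (u x))) $ \<alpha> $ l)" for i \<alpha>
      by (rule entry[OF f u x])
    show "rank (jacobian u (at x)) \<le> CARD('k)"
      unfolding implicit_solution_jacobian[OF lam_smooth f u x]
      using rank_mul_le_left rank_bound by (metis min.bounded_iff order_trans)
  }
  {
    fix N and u :: "real^'p \<Rightarrow> real^'q" assume u: "smooth_map_near0 N u U"
    then have N: "open N" "0 \<in> N" "smooth_on N u" "u ` N \<subseteq> U"
      by (auto simp: smooth_map_near0_def)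
    let ?s = "\<lambda>x. riemann_invariants lam x (u x)"
    show "(\<exists>W f. smooth_map_near0 W f U \<and> (\<forall>\<^sub>F x in nhds 0. ?s x \<in> W \<and> u x = f (?s x))) \<longleftrightarrow>
      (\<exists>M. open M \<and> 0 \<in> M \<and> M \<subseteq> N \<and>
        (\<forall>a < ?n. invariant_under (horizontal_field (\<xi> a)) (graph_over M u)))" (is "?F \<longleftrightarrow> ?I")
    proof
      assume ?F
      then obtain W f where f: "smooth_map_near0 W f U"
        and "\<forall>\<^sub>F x in nhds 0. ?s x \<in> W \<and> u x = f (?s x)" by blast
      then obtain Q where Q: "open Q" "0 \<in> Q" "\<And>x. x \<in> Q \<Longrightarrow> ?s x \<in> W \<and> u x = f (?s x)"
        unfolding eventually_nhds by blast
      have sol: "implicit_solution lam U W f (N \<inter> Q) u"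
        unfolding implicit_solution_def
      proof
        show "smooth_map_near0 (N \<inter> Q) u U"
          using N(1,2,4) Q(1,2) smooth_on_subset[OF N(3) Int_lower1]
          by (auto simp: smooth_map_near0_def)
        show "\<forall>x\<in>N \<inter> Q. ?s x \<in> W \<and> u x = f (?s x)"
          by (intro ballI Q(3)) (erule IntD2)
      qed
      obtain M where M: "open M" "0 \<in> M" "M \<subseteq> N \<inter> Q"
        and phi: "\<And>x. x \<in> M \<Longrightarrow> invertible (phi_matrix lam f u x)"
        using phi_matrix_invertible_near_0[OF lam_smooth f sol] by blast
      have uM: "smooth_on M u" using N(3) by (rule smooth_on_subset) (use M in blast)
      have "frechet_derivative u (at x) (\<xi> a (u x)) = 0" if x: "x \<in> M" and a: "a < ?n" for x a
      proof -
        have xN: "x \<in> N \<inter> Q" and ux: "u x \<in> U" using x M N(4) by blast+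
        have "frechet_derivative u (at x) (\<xi> a (u x)) = jacobian u (at x) *v \<xi> a (u x)"
          by (simp flip: frechet_derivative_at[OF smooth_on_jacobian[OF uM x]])
        also have "\<dots> = 0"
          by (simp add: implicit_solution_jacobian[OF lam_smooth f sol xN phi[OF x]] ann[OF ux a]
              flip: matrix_vector_mul_assoc)
        finally show ?thesis .
      qed
      then have "\<forall>a < ?n. invariant_under (horizontal_field (\<xi> a)) (graph_over M u)"
        using invariant_under_horizontal_field_iff[OF M(1) uM] by blast
      with M show ?I by blast
    next
      assume ?I
      then obtain M where M: "open M" "0 \<in> M" "M \<subseteq> N"
        and inv: "\<And>a. a < ?n \<Longrightarrow> invariant_under (horizontal_field (\<xi> a)) (graph_over M u)" by blast
      have uM: "smooth_on M u" using N(3) M(3) by (rule smooth_on_subset)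
      have "jacobian u (at x) *v \<xi> a (u x) = 0" if "x \<in> M" "a < ?n" for x a
        using inv[OF that(2)] that(1) frechet_derivative_at[OF smooth_on_jacobian[OF uM that(1)]]
        unfolding invariant_under_horizontal_field_iff[OF M(1) uM] by metis
      then show ?F
        using N(4) M(3)
        by (intro invariant_graph_locally_factors[OF lam_smooth lam_indep xi_indep ann M(1,2) uM]) blast+
    qed
  }
  {
    fix W f N M and u :: "real^'p \<Rightarrow> real^'q"
    assume f: "smooth_map_near0 W f U" and u: "implicit_solution lam U W f N u"
      and "open M \<and> 0 \<in> M \<and> M \<subseteq> N \<and> (\<forall>x\<in>M. invertible (phi_matrix lam f u x))"
    then have M: "x \<in> N" "invertible (phi_matrix lam f u x)" if "x \<in> M" for x
      using that by auto
    let ?c = "\<lambda>x l j i. matrix_inv (phi_matrix lam f u x) $ l $ j * lam j (u x) $ i"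
    let ?f = "\<lambda>x l. column l (jacobian f (at (riemann_invariants lam x (u x))))"
    have "A i (u x) *v column i (jacobian u (at x)) =
        (\<Sum>l\<in>UNIV. \<Sum>j\<in>UNIV. ?c x l j i *\<^sub>R (A i (u x) *v ?f x l))" if "x \<in> M" for x i
    proof -
      have "column i (jacobian u (at x)) = (\<Sum>l\<in>UNIV. \<Sum>j\<in>UNIV. ?c x l j i *\<^sub>R ?f x l)"
        by (simp add: vec_eq_iff column_def entry[OF f u M[OF that]])
      then show ?thesis
        by (simp add: linear_sum[OF matrix_vector_mul_linear] matrix_vector_mult_scaleR)
    qed
    then show "quasilinear_solution_on M A u \<longleftrightarrow>
        (\<forall>x\<in>M. (\<Sum>i\<in>UNIV. \<Sum>l\<in>UNIV. \<Sum>j\<in>UNIV. ?c x l j i *\<^sub>R (A i (u x) *v ?f x l)) = 0)"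
      unfolding quasilinear_solution_on_def by simp
  }
qed

end
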